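(* For every integer $n\ge 3$, $$U(n)\le \frac{4}{3}n-2.$$
   Context: For a finite point set $P\subset\mathbb{R}^2$ in general position (no three collinear), ${\rm CH}(P)$ denotes the convex hull of $P$. A set $\Pi$ of closed convex polygons with vertices in $P$ and with pairwise disjoint interiors is called a convex decomposition of $P$ if the union of the polygons in $\Pi$ is ${\rm CH}(P)$ and no point of $P$ lies in the interior of any element of $\Pi$. $u(P)$ denotes the minimum number of elements of a convex decomposition of $P$. $U(n)$ denotes the maximum of $u(P)$ over all sets $P$ of $n$ points in general position in the plane. *)

theory Defs
  imports "HOL-Analysis.Analysis"
begin

type_synonym point = "real ^ 2"

definition general_position :: "point set \<Rightarrow> bool" where
  "general_position P \<longleftrightarrow>
     (\<forall>a\<in>P. \<forall>b\<in>P. \<forall>c\<in>P. a \<noteq> b \<longrightarrow> a \<noteq> c \<longrightarrow> b \<noteq> c \<longrightarrow> \<not> collinear {a, b, c})"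

text \<open>A closed convex polygon is a nondegenerate polytope in the plane; its vertices are its
  extreme points.\<close>

definition convex_polygon :: "point set \<Rightarrow> bool" where
  "convex_polygon K \<longleftrightarrow> polytope K \<and> aff_dim K = 2"

definition vertices :: "point set \<Rightarrow> point set" where
  "vertices K = {v. v extreme_point_of K}"

definition convex_decomposition :: "point set \<Rightarrow> point set set \<Rightarrow> bool" where
  "convex_decomposition P D \<longleftrightarrow>
     (\<forall>K\<in>D. convex_polygon K \<and> vertices K \<subseteq> P) \<and>
     pairwise (\<lambda>K L. disjnt (interior K) (interior L)) D \<and>
     \<Union>D = convex hull P \<and>
     (\<forall>K\<in>D. interior K \<inter> P = {})"

text \<open>For finite \<open>P\<close>, every convex decomposition of \<open>P\<close> is a finite set, since a polytope is the
  convex hull of its extreme points; hence \<^const>\<open>card\<close> is the true number of elements.\<close>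

definition min_decomposition :: "point set \<Rightarrow> nat" where
  "min_decomposition P = (LEAST k. \<exists>D. convex_decomposition P D \<and> card D = k)"

text \<open>\<open>Max\<close> ranges over a nonempty set bounded in terms of \<open>n\<close> for \<open>n \<ge> 3\<close>, so it is a genuine
  maximum there.\<close>

definition max_min_decomposition :: "nat \<Rightarrow> nat" where
  "max_min_decomposition n =
     Max {min_decomposition P | P. finite P \<and> card P = n \<and> general_position P}"

end

theory Submission
  imports Defs
begin

text \<open>
  Put a vertex of the convex hull at the origin and sort the other points by angle around it. In
  this order they form a chain that runs around the origin through less than a half turn. An
  inner point of a chain is a peak if the chain bulges away from the origin there and a valley if
  it bulges towards it. Cells between the origin and a chain need one cut for every valley, namely
  the segment to the origin (\<open>tiled_star\<close>). Beyond the chain, a region between a lower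
  chain of valleys and an upper chain of peaks with the same ends is a convex polygon, so one cell
  replaces the lower chain by the upper one (\<open>tiled_replace\<close>). Capping valleys one at a
  time ends at the convex hull (\<open>tiled_hull\<close>).

  Let the chain of all points have \<open>s\<close> valleys, in \<open>R\<close> maximal runs. With one
  cap per run and then one triangle per valley of the remaining chain of peaks, this costs
  \<open>(s + 1) + R + (n - 1 - s - 2) = n - 2 + R\<close> cells, which is too much only if the runs are
  short and close to each other. Two savings repair this.

  \<^item> If all peaks between two consecutive runs are still peaks in the chain of peaks, then dropping
    these peaks from the lower chain saves one cell: the last point of the first run is joined to
    the first point of the second run. If both points remain valleys, one cap serves both runs. A
    point that becomes a peak requires one more cap, but no longer a segment to the origin
    (\<open>open_run\<close>).

  \<^item> If two adjacent points of the chain of peaks are valleys of that chain, then they are removed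
    by one quadrilateral instead of two triangles (\<open>capped_quad\<close>).

  A saving of the first kind uses up two runs, and savings of the second kind must not overlap.
  Reading the points by increasing angle and saving whenever possible, one pays for a run and gains
  for every point read. The balance is the quantity \<open>excess\<close>; a finite automaton keeps track
  of the runs and valleys that are still available for a saving, and in each of its states the
  excess is bounded (\<open>peak_chain_invariant\<close>). The bound 2, valid in all states, is exactly what
  is needed: the number \<open>k\<close> of cells satisfies \<open>3 * k + 2 \<le> 4 * (n - 1)\<close>.

  Distances from the origin are measured relative to a chain. On the wedge spanned by an edge, the
  level of a point is the linear function that equals 1 on the edge. These functions fit
  together to a positively homogeneous function on the wedge of the chain, whose sublevel set at 1
  is the region between the origin and the chain. It is convex for a chain of peaks and concave for
  a chain of valleys (\<open>chain_level_convexity\<close>), so convexity of cells, disjointness of their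
  interiors and emptiness are inequalities between levels along rays.
\<close>

section \<open>Orientation and wedges\<close>

definition cross :: "point \<Rightarrow> point \<Rightarrow> real" where
  "cross u v = u $ 1 * v $ 2 - u $ 2 * v $ 1"

text \<open>Twice the signed area of the triangle \<open>a b c\<close>, written so that it is visibly additive in
  the areas seen from the origin. On a chain that runs counterclockwise around the origin it is
  positive at a peak and negative at a valley.\<close>

definition turn :: "point \<Rightarrow> point \<Rightarrow> point \<Rightarrow> real" where
  "turn a b c = cross a b + cross b c - cross a c"

lemma cross_simps [simp]:
  "cross (u + u') v = cross u v + cross u' v"
  "cross u (v + v') = cross u v + cross u v'"
  "cross (t *\<^sub>R u) v = t * cross u v"
  "cross u (t *\<^sub>R v) = t * cross u v"
  "cross u u = 0" "cross 0 u = 0" "cross u 0 = 0"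
  by (simp_all add: cross_def algebra_simps)

lemma cross_swap: "cross v u = - cross u v"
  by (simp add: cross_def algebra_simps)

text \<open>This is the cone spanned by \<open>a\<close> and \<open>c\<close> as long as \<open>cross a c\<close> is
  positive; only such pairs are of interest.\<close>

definition wedge :: "point \<Rightarrow> point \<Rightarrow> point set" where
  "wedge a c = {p. 0 \<le> cross a p \<and> 0 \<le> cross p c}"

lemma wedge_combination:
  assumes "cross a c \<noteq> 0"
  shows "p = (cross p c / cross a c) *\<^sub>R a + (cross a p / cross a c) *\<^sub>R c"
proof -
  have "cross a c *\<^sub>R p = cross p c *\<^sub>R a + cross a p *\<^sub>R c"
    by (simp add: vec_eq_iff forall_2 cross_def algebra_simps)
  then have "(1 / cross a c) *\<^sub>R (cross a c *\<^sub>R p) = (1 / cross a c) *\<^sub>R (cross p c *\<^sub>R a + cross a p *\<^sub>R c)"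
    by simp
  then show ?thesis using assms by (simp add: scaleR_add_right)
qed

lemma wedge_cases:
  assumes "p \<in> wedge a c" "cross a c > 0"
  obtains \<alpha> \<beta> where "0 \<le> \<alpha>" "0 \<le> \<beta>" "p = \<alpha> *\<^sub>R a + \<beta> *\<^sub>R c"
proof -
  have "0 \<le> cross p c / cross a c" "0 \<le> cross a p / cross a c" using assms by (auto simp: wedge_def)
  then show thesis using that wedge_combination[of a c p] assms(2) by (metis less_irrefl)
qed

section \<open>Chains around the origin and their levels\<close>

text \<open>The linear function with value 1 at \<open>a\<close> and at \<open>b\<close>.\<close>

definition level :: "point \<Rightarrow> point \<Rightarrow> point \<Rightarrow> real" where
  "level a b p = (cross a p + cross p b) / cross a b"

lemma level_linear: "level a b (s *\<^sub>R x + t *\<^sub>R y) = s * level a b x + t * level a b y"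
  by (simp add: level_def add_divide_distrib [symmetric] algebra_simps)

lemma level_combination:
  "cross a b \<noteq> 0 \<Longrightarrow> level a b (s *\<^sub>R a + t *\<^sub>R b) = s + t"
  by (simp add: level_def field_simps)

text \<open>Both levels equal 1 at \<open>b\<close>, so their difference is a multiple of \<open>cross p b\<close>. The
  sign of the factor is that of the turn at \<open>b\<close>; all convexity statements about chains go back to
  this identity.\<close>

lemma level_diff:
  assumes "cross a b > 0" "cross b c > 0"
  shows "level a b p - level b c p = turn a b c * cross p b / (cross a b * cross b c)"
proof -
  have "(cross a p + cross p b) * cross b c - (cross b p + cross p c) * cross a b = turn a b c * cross p b"
    by (simp add: turn_def cross_def algebra_simps)
  then show ?thesis using assms by (simp add: level_def field_simps)
qed

fun edges :: "point list \<Rightarrow> (point \<times> point) set" where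
  "edges (a # b # L) = insert (a, b) (edges (b # L))"
| "edges _ = {}"

lemma edges_append: "edges (xs @ z # ys) = edges (xs @ [z]) \<union> edges (z # ys)"
proof (induction xs)
  case (Cons x xs)
  then show ?case by (cases xs) auto
qed simp

lemma edges_set: "(a, b) \<in> edges L \<Longrightarrow> a \<in> set L \<and> b \<in> set (tl L)"
  by (induction L rule: edges.induct) auto

text \<open>Orientation is required for all pairs, not only for neighbours: it need not be transitive, and
  all pairs together say that the list turns by less than a half turn.\<close>

definition fan :: "point list \<Rightarrow> bool" where
  "fan L \<longleftrightarrow> sorted_wrt (\<lambda>u v. 0 < cross u v) L"

lemma fan_edge: "fan L \<Longrightarrow> (a, b) \<in> edges L \<Longrightarrow> 0 < cross a b"
  by (induction L rule: edges.induct) (auto simp: fan_def)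

lemma fan_Nil [simp]: "fan []"
  by (simp add: fan_def)

lemma fan_append: "fan (xs @ ys) \<longleftrightarrow> fan xs \<and> fan ys \<and> (\<forall>x\<in>set xs. \<forall>y\<in>set ys. 0 < cross x y)"
  by (simp add: fan_def sorted_wrt_append)

lemma fan_Cons: "fan (x # ys) \<longleftrightarrow> fan ys \<and> (\<forall>y\<in>set ys. 0 < cross x y)"
  by (auto simp add: fan_def)

lemma fan_ends:
  assumes "fan L" "2 \<le> length L"
  shows "0 < cross (hd L) (last L)"
proof -
  obtain a M where "L = a # M" "M \<noteq> []" using assms by (cases L) (auto simp: Suc_le_eq)
  then show ?thesis using assms by (simp add: fan_Cons)
qed

lemma fan_sector:
  assumes "fan L" "2 \<le> length L" "p \<in> wedge (hd L) (last L)"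
  obtains a b where "(a, b) \<in> edges L" "p \<in> wedge a b"
proof -
  have "\<exists>a b. (a, b) \<in> edges L \<and> p \<in> wedge a b"
    using assms
  proof (induction L rule: edges.induct)
    case (1 a b L)
    show ?case
    proof (cases "L = [] \<or> cross b p \<le> 0")
      case True
      then show ?thesis using 1(4) by (auto simp: wedge_def cross_swap[of b p])
    next
      case False
      then have "p \<in> wedge (hd (b # L)) (last (b # L))"
        using 1(4) by (auto simp: wedge_def)
      moreover have "fan (b # L)" "2 \<le> length (b # L)"
        using 1 False by (auto simp: fan_Cons Suc_le_eq)
      ultimately show ?thesis using 1(1) by auto
    qed
  qed auto
  then show thesis using that by blast
qed

text \<open>The edge that determines the level is the first one whose end point is not passed by the ray
  through \<open>p\<close>. The value on lists without an edge is arbitrary.\<close>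

fun chain_level :: "point list \<Rightarrow> point \<Rightarrow> real" where
  "chain_level (a # b # c # L) p = (if cross b p \<le> 0 then level a b p else chain_level (b # c # L) p)"
| "chain_level [a, b] p = level a b p"
| "chain_level _ p = 0"

text \<open>A ray through a vertex belongs to two wedges. The levels of both edges agree there, so the
  choice made in the recursion does not matter.\<close>

lemma chain_level_sector:
  "fan L \<Longrightarrow> (u, v) \<in> edges L \<Longrightarrow> p \<in> wedge u v \<Longrightarrow> chain_level L p = level u v p"
proof (induction L p rule: chain_level.induct)
  case (1 a b c L p)
  have uv: "0 < cross u v" using 1 fan_edge by blast
  show ?case
  proof (cases "(u, v) = (a, b)")
    case True
    then show ?thesis using 1 by (auto simp: wedge_def cross_swap[of b p])
  next
    case False
    then have e: "(u, v) \<in> edges (b # c # L)" using 1 by auto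
    have f: "fan (b # c # L)" using 1 by (simp add: fan_Cons)
    obtain \<alpha> \<beta> where p: "0 \<le> \<alpha>" "0 \<le> \<beta>" "p = \<alpha> *\<^sub>R u + \<beta> *\<^sub>R v"
      using wedge_cases[OF 1(4) uv] by metis
    show ?thesis
    proof (cases "cross b p \<le> 0")
      case True
      have ab: "0 < cross a b" and bv: "0 < cross b v"
        using 1(2) edges_set[OF e] by (auto simp: fan_Cons)
      have bu: "u = b \<or> 0 < cross b u" using edges_set[OF e] f by (auto simp: fan_Cons)
      then have "0 \<le> cross b u" by auto
      then have "0 \<le> \<alpha> * cross b u" "0 \<le> \<beta> * cross b v" using p bv by auto
      then have z: "\<alpha> * cross b u = 0" "\<beta> * cross b v = 0"
        using True p(3) unfolding p(3) cross_simps by linarith+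
      then have "\<beta> = 0" using bv by simp
      moreover have "\<alpha> = 0 \<or> u = b" using z bu by auto
      ultimately show ?thesis using True p(3) ab uv by (auto simp: level_def)
    next
      case False
      then show ?thesis using 1(1)[OF False f e 1(4)] by simp
    qed
  qed
qed auto

lemma chain_level_combination:
  assumes "fan L" "(u, v) \<in> edges L" "0 \<le> \<alpha>" "0 \<le> \<beta>"
  shows "chain_level L (\<alpha> *\<^sub>R u + \<beta> *\<^sub>R v) = \<alpha> + \<beta>"
proof -
  have "0 < cross u v" using fan_edge assms by blast
  then have "\<alpha> *\<^sub>R u + \<beta> *\<^sub>R v \<in> wedge u v" using assms by (simp add: wedge_def)
  then show ?thesis using chain_level_sector[OF assms(1,2)] level_combination \<open>0 < cross u v\<close> by simp
qed

text \<open>The form in which levels are computed: the level is the sum of the coefficients in terms of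
  the edge met by the ray.\<close>

lemma fan_polar:
  assumes "fan L" "2 \<le> length L" "p \<in> wedge (hd L) (last L)"
  obtains u v \<alpha> \<beta> where "(u, v) \<in> edges L" "p \<in> wedge u v" "0 \<le> \<alpha>" "0 \<le> \<beta>"
    "p = \<alpha> *\<^sub>R u + \<beta> *\<^sub>R v" "chain_level L p = \<alpha> + \<beta>"
proof -
  obtain u v where uv: "(u, v) \<in> edges L" "p \<in> wedge u v" using fan_sector[OF assms] .
  then have "0 < cross u v" using fan_edge assms by blast
  then obtain \<alpha> \<beta> where "0 \<le> \<alpha>" "0 \<le> \<beta>" "p = \<alpha> *\<^sub>R u + \<beta> *\<^sub>R v" using wedge_cases uv by metis
  then show thesis using that uv chain_level_combination assms by metis
qed

lemma wedge_scale: "0 \<le> t \<Longrightarrow> p \<in> wedge a c \<Longrightarrow> t *\<^sub>R p \<in> wedge a c"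
  by (simp add: wedge_def)

lemma chain_level_scale:
  assumes "fan L" "2 \<le> length L" "p \<in> wedge (hd L) (last L)" "0 \<le> t"
  shows "chain_level L (t *\<^sub>R p) = t * chain_level L p"
proof -
  obtain u v \<alpha> \<beta> where h: "(u, v) \<in> edges L" "0 \<le> \<alpha>" "0 \<le> \<beta>"
    "p = \<alpha> *\<^sub>R u + \<beta> *\<^sub>R v" "chain_level L p = \<alpha> + \<beta>" using fan_polar[OF assms(1-3)] by metis
  have "t *\<^sub>R p = (t * \<alpha>) *\<^sub>R u + (t * \<beta>) *\<^sub>R v" using h by (simp add: scaleR_add_right)
  then show ?thesis using chain_level_combination[OF assms(1) h(1), of "t * \<alpha>" "t * \<beta>"] h assms
    by (simp add: distrib_left)
qed

lemma set_in_edges: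
  assumes "2 \<le> length L" "x \<in> set L"
  obtains y where "(x, y) \<in> edges L \<or> (y, x) \<in> edges L"
proof -
  have "\<exists>y. (x, y) \<in> edges L \<or> (y, x) \<in> edges L"
    using assms
  proof (induction L rule: edges.induct)
    case (1 a b L)
    show ?case
    proof (cases "x = a \<or> x = b")
      case False
      then have "L \<noteq> []" "x \<in> set (b # L)" using 1 by auto
      then show ?thesis using 1 by (auto simp: Suc_le_eq)
    qed auto
  qed auto
  then show thesis using that by blast
qed

lemma chain_level_vertex:
  assumes "fan L" "2 \<le> length L" "x \<in> set L"
  shows "chain_level L x = 1"
proof -
  obtain y where "(x, y) \<in> edges L \<or> (y, x) \<in> edges L" using set_in_edges assms by blast
  then show ?thesis
    using chain_level_combination[OF assms(1), of x y 1 0] chain_level_combination[OF assms(1), of y x 0 1] by auto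
qed

lemma fan_set_wedge:
  assumes "fan L" "2 \<le> length L" "x \<in> set L"
  shows "x \<in> wedge (hd L) (last L)"
proof -
  obtain a M where L: "L = a # M" "M \<noteq> []" using assms by (cases L) (auto simp: Suc_le_eq)
  obtain N b where M: "M = N @ [b]" using L by (metis rev_exhaust)
  have "x = a \<or> 0 < cross a x" "x = b \<or> 0 < cross x b"
    using assms unfolding L M by (auto simp: fan_Cons fan_append)
  then show ?thesis unfolding L M wedge_def using L(2) by auto
qed

text \<open>Levels are local: replacing a part of a chain changes them only within the wedge of that
  part. The next lemma is the other half of this statement.\<close>

lemma chain_level_inside:
  assumes "fan (xs @ A @ ys)" "2 \<le> length A" "p \<in> wedge (hd A) (last A)"
  shows "chain_level (xs @ A @ ys) p = chain_level A p"
proof -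
  have fA: "fan A" using assms by (simp add: fan_append)
  obtain a b where ab: "(a, b) \<in> edges A" "p \<in> wedge a b" using fan_sector[OF fA assms(2,3)] .
  have "edges A \<subseteq> edges (xs @ A @ ys)"
  proof -
    obtain z Z where A: "A = z # Z" using assms by (cases A) auto
    have "A = butlast A @ [last A]" using A by (metis append_butlast_last_id list.distinct(1))
    then have "edges A \<subseteq> edges (A @ ys)" using edges_append[of "butlast A" "last A" ys]
      by (metis Un_upper1 append_Cons append_assoc append_Nil)
    also have "\<dots> \<subseteq> edges (xs @ A @ ys)" using edges_append[of xs z "Z @ ys"] A by auto
    finally show ?thesis .
  qed
  then show ?thesis using chain_level_sector ab assms fA by (metis subsetD)
qed

lemma chain_level_outside:
  assumes fA: "fan (xs @ A @ ys)" and fB: "fan (xs @ B @ ys)"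
    and ne: "A \<noteq> []" "B \<noteq> []" and hl: "hd A = hd B" "last A = last B"
    and p: "p \<in> wedge (hd (xs @ A @ ys)) (last (xs @ A @ ys))" "p \<notin> wedge (hd A) (last A)"
  shows "chain_level (xs @ A @ ys) p = chain_level (xs @ B @ ys) p"
proof -
  consider "cross (hd A) p < 0" | "cross p (last A) < 0" using p(2) by (force simp: wedge_def)
  then show ?thesis
  proof cases
    case 1
    then have xs: "xs \<noteq> []" using p(1) ne by (auto simp: wedge_def)
    have f: "fan (xs @ [hd A])" using fA ne by (cases A) (auto simp: fan_def sorted_wrt_append)
    have "2 \<le> length (xs @ [hd A])" using xs by (cases xs) auto
    moreover have "p \<in> wedge (hd (xs @ [hd A])) (last (xs @ [hd A]))"
      using p(1) xs 1 by (simp add: wedge_def cross_swap[of p "hd A"])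
    ultimately obtain a b where ab: "(a, b) \<in> edges (xs @ [hd A])" "p \<in> wedge a b"
      using f fan_sector by metis
    have "(a, b) \<in> edges (xs @ A @ ys)" "(a, b) \<in> edges (xs @ B @ ys)"
      using ab edges_append[of xs "hd A" "tl A @ ys"] edges_append[of xs "hd B" "tl B @ ys"] ne hl
      by (metis UnI1 append_Cons list.collapse)+
    then show ?thesis using chain_level_sector ab fA fB by metis
  next
    case 2
    then have ys: "ys \<noteq> []" using p(1) ne by (auto simp: wedge_def)
    define z where "z = last A"
    have dA: "A = butlast A @ [z]" and dB: "B = butlast B @ [z]"
      using ne hl z_def by (metis append_butlast_last_id)+
    have f: "fan (z # ys)" using fA dA by (auto simp: fan_append fan_Cons z_def ne)
    have "2 \<le> length (z # ys)" using ys by (cases ys) auto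
    moreover have "p \<in> wedge (hd (z # ys)) (last (z # ys))"
      using p(1) ys 2 by (simp add: wedge_def cross_swap[of "last A" p] z_def)
    ultimately obtain a b where ab: "(a, b) \<in> edges (z # ys)" "p \<in> wedge a b"
      using f fan_sector by metis
    have e: "xs @ A @ ys = (xs @ butlast A) @ z # ys" "xs @ B @ ys = (xs @ butlast B) @ z # ys"
      using dA dB by (metis append_assoc append_Cons append_Nil)+
    have "(a, b) \<in> edges (xs @ A @ ys)" "(a, b) \<in> edges (xs @ B @ ys)"
      unfolding e edges_append[of _ z ys] using ab by simp_all
    then show ?thesis using chain_level_sector ab fA fB by metis
  qed
qed

section \<open>Convexity of the level for peaks and concavity for valleys\<close>

text \<open>With \<open>\<sigma> = 1\<close> all inner points are peaks, with \<open>\<sigma> = -1\<close> all are valleys. The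
  sign is a parameter because both cases have the same proof, with inequalities reversed.\<close>

fun bends :: "real \<Rightarrow> point list \<Rightarrow> bool" where
  "bends \<sigma> (a # b # c # L) \<longleftrightarrow> 0 < \<sigma> * turn a b c \<and> bends \<sigma> (b # c # L)"
| "bends _ _ \<longleftrightarrow> True"

text \<open>The induction in the next lemma passes to final parts of the chain, whose wedges need not contain
  \<open>p\<close>. What remains true for them is that the vertices before the ray of \<open>p\<close> precede those
  after it.\<close>

lemma fan_position:
  assumes "fan L" "p \<in> wedge (hd L) (last L)"
  shows "sorted_wrt (\<lambda>u v. cross u p \<le> 0 \<longrightarrow> cross v p \<le> 0) L"
  unfolding sorted_wrt_iff_nth_less
proof (intro allI impI)
  fix i j assume ij: "i < j" "j < length L" and le: "cross (L ! i) p \<le> 0"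
  let ?h = "hd L" and ?u = "L ! i" and ?v = "L ! j"
  have ne: "L \<noteq> []" using ij by auto
  then have h0: "?h = L ! 0" by (simp add: hd_conv_nth)
  have S: "\<And>k l. k < l \<Longrightarrow> l < length L \<Longrightarrow> 0 < cross (L ! k) (L ! l)"
    using assms(1) by (simp add: fan_def sorted_wrt_iff_nth_less)
  show "cross ?v p \<le> 0"
  proof (cases "i = 0")
    case True
    have "2 \<le> length L" using ij by linarith
    then have hl: "0 < cross ?h (last L)" using fan_ends assms by simp
    obtain \<alpha> \<beta> where ab: "0 \<le> \<alpha>" "0 \<le> \<beta>" "p = \<alpha> *\<^sub>R ?h + \<beta> *\<^sub>R last L"
      using wedge_cases[OF assms(2) hl] .
    have "\<beta> * cross ?h (last L) \<le> 0" using le True ab h0 by simp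
    then have "\<beta> = 0" using ab hl by (simp add: mult_le_0_iff)
    have "0 < cross ?h ?v" using S ij True h0 by simp
    then show ?thesis using ab \<open>\<beta> = 0\<close> by (simp add: cross_swap[of ?v ?h])
  next
    case False
    have hu: "0 < cross ?h ?u" using S[of 0 i] False ij h0 by simp
    have "p \<in> wedge ?h ?u" using assms(2) le by (simp add: wedge_def cross_swap[of p ?u])
    then obtain \<alpha> \<beta> where ab: "0 \<le> \<alpha>" "0 \<le> \<beta>" "p = \<alpha> *\<^sub>R ?h + \<beta> *\<^sub>R ?u"
      using wedge_cases hu by metis
    have "0 < cross ?h ?v" "0 < cross ?u ?v" using S[of 0 j] S[of i j] False ij h0 by auto
    then have "0 \<le> \<alpha> * cross ?h ?v + \<beta> * cross ?u ?v" using ab by simp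
    then show ?thesis using ab(3) by (simp add: cross_swap[of ?v])
  qed
qed

text \<open>For peaks the level is the maximum of the levels of all edges, for valleys the minimum. Moving
  away from the ray of \<open>p\<close> along the chain, \<open>level_diff\<close> shows at each vertex that the
  levels of the edges change monotonically.\<close>

lemma level_le_chain_level_aux:
  "bends \<sigma> L \<Longrightarrow> fan L \<Longrightarrow> sorted_wrt (\<lambda>u v. cross u p \<le> 0 \<longrightarrow> cross v p \<le> 0) L \<Longrightarrow>
    (a, b) \<in> edges L \<Longrightarrow> \<sigma> * level a b p \<le> \<sigma> * chain_level L p"
proof (induction L arbitrary: a b rule: edges.induct)
  case (1 u v M)
  show ?case
  proof (cases M)
    case Nil
    then show ?thesis using 1 by simp
  next
    case (Cons w L)
    note prems = 1(2-5)[unfolded Cons]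
    have uv: "0 < cross u v" "0 < cross v w" and f: "fan (v # w # L)"
      using prems(2) by (auto simp: fan_Cons)
    define K where "K = \<sigma> * turn u v w / (cross u v * cross v w)"
    have "0 < K" using prems(1) uv by (simp add: K_def)
    have d: "\<sigma> * level u v p - \<sigma> * level v w p = K * cross p v"
      using level_diff[OF uv, of p] by (simp add: K_def right_diff_distrib [symmetric] mult.assoc)
    have IH: "\<sigma> * level a b p \<le> \<sigma> * chain_level (v # w # L) p" if "(a, b) \<in> edges (v # w # L)" for a b
    proof (rule 1(1)[unfolded Cons])
      show "bends \<sigma> (v # w # L)" using prems(1) by (simp only: bends.simps)
      show "sorted_wrt (\<lambda>u v. cross u p \<le> 0 \<longrightarrow> cross v p \<le> 0) (v # w # L)"
        using prems(3) unfolding sorted_wrt.simps(2)[of _ u] by blast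
    qed (fact f that)+
    have ab: "(a, b) = (u, v) \<or> (a, b) \<in> edges (v # w # L)" using prems(4) by auto
    show ?thesis
    proof (cases "cross v p \<le> 0")
      case True
      then have "0 \<le> K * cross p v" using \<open>0 < K\<close> by (simp add: cross_swap[of p v] mult_le_0_iff)
      then have le: "\<sigma> * level v w p \<le> \<sigma> * level u v p" using d by linarith
      have "cross w p \<le> 0" using prems(3) True by simp
      then have "chain_level (v # w # L) p = level v w p" by (cases L) auto
      moreover have "chain_level (u # v # w # L) p = level u v p" using True by simp
      moreover have "\<sigma> * level a b p \<le> \<sigma> * chain_level (v # w # L) p" if "(a, b) \<noteq> (u, v)"
        using IH[of a b] ab that by blast
      ultimately show ?thesis using le unfolding Cons by (cases "(a, b) = (u, v)") simp_all
    next
      case False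
      then have "K * cross p v < 0" using \<open>0 < K\<close> by (simp add: cross_swap[of p v] mult_less_0_iff)
      then have "\<sigma> * level u v p \<le> \<sigma> * level v w p" using d by linarith
      moreover have "\<sigma> * level v w p \<le> \<sigma> * chain_level (v # w # L) p" using IH[of v w] by simp
      moreover have "chain_level (u # v # w # L) p = chain_level (v # w # L) p" using False by simp
      moreover have "\<sigma> * level a b p \<le> \<sigma> * chain_level (v # w # L) p" if "(a, b) \<noteq> (u, v)"
        using IH[of a b] ab that by blast
      ultimately show ?thesis unfolding Cons by (cases "(a, b) = (u, v)") simp_all
    qed
  qed
qed auto

lemma level_le_chain_level:
  assumes "bends \<sigma> L" "fan L" "p \<in> wedge (hd L) (last L)" "(a, b) \<in> edges L"
  shows "\<sigma> * level a b p \<le> \<sigma> * chain_level L p"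
  using level_le_chain_level_aux[OF assms(1,2) fan_position[OF assms(2,3)] assms(4)] .

lemma wedge_combine:
  assumes "0 \<le> s" "0 \<le> t" "x \<in> wedge a c" "y \<in> wedge a c"
  shows "s *\<^sub>R x + t *\<^sub>R y \<in> wedge a c"
  using assms by (auto simp: wedge_def intro!: add_nonneg_nonneg mult_nonneg_nonneg)

text \<open>A maximum of linear functions is convex and a minimum is concave.\<close>

lemma chain_level_convexity:
  assumes "bends \<sigma> L" "fan L" "2 \<le> length L" "0 \<le> s" "0 \<le> t"
    and x: "x \<in> wedge (hd L) (last L)" and y: "y \<in> wedge (hd L) (last L)"
  shows "\<sigma> * chain_level L (s *\<^sub>R x + t *\<^sub>R y) \<le> s * (\<sigma> * chain_level L x) + t * (\<sigma> * chain_level L y)"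
proof -
  let ?z = "s *\<^sub>R x + t *\<^sub>R y"
  have "?z \<in> wedge (hd L) (last L)" using wedge_combine[OF assms(4-7)] .
  then obtain a b where ab: "(a, b) \<in> edges L" "?z \<in> wedge a b" using fan_sector[OF assms(2,3)] by metis
  have "\<sigma> * chain_level L ?z = s * (\<sigma> * level a b x) + t * (\<sigma> * level a b y)"
    using chain_level_sector[OF assms(2) ab] by (simp add: level_linear algebra_simps)
  also have "\<dots> \<le> s * (\<sigma> * chain_level L x) + t * (\<sigma> * chain_level L y)"
    using level_le_chain_level[OF assms(1,2) x ab(1)] level_le_chain_level[OF assms(1,2) y ab(1)]
    by (intro add_mono mult_left_mono[OF _ assms(4)] mult_left_mono[OF _ assms(5)])
  finally show ?thesis .
qed

text \<open>By convexity it suffices to compare at the two ends, where both sides are \<open>\<sigma>\<close>. Hence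
  peaks lie beyond the chord of a chain and valleys below it.\<close>

lemma chain_level_vs_chord:
  assumes "bends \<sigma> L" "fan L" "2 \<le> length L" "p \<in> wedge (hd L) (last L)"
  shows "\<sigma> * chain_level L p \<le> \<sigma> * level (hd L) (last L) p"
proof -
  let ?a = "hd L" and ?c = "last L"
  have ac: "0 < cross ?a ?c" using fan_ends[OF assms(2,3)] .
  obtain \<alpha> \<beta> where p: "0 \<le> \<alpha>" "0 \<le> \<beta>" "p = \<alpha> *\<^sub>R ?a + \<beta> *\<^sub>R ?c"
    using wedge_cases[OF assms(4) ac] .
  have L: "?a \<in> set L" "?c \<in> set L" using assms(3) by (cases L; simp)+
  have "\<sigma> * chain_level L p \<le> \<alpha> * (\<sigma> * chain_level L ?a) + \<beta> * (\<sigma> * chain_level L ?c)"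
    unfolding p(3) by (intro chain_level_convexity fan_set_wedge assms L p)
  also have "\<dots> = \<sigma> * (\<alpha> + \<beta>)" using chain_level_vertex[OF assms(2,3)] L by (simp add: algebra_simps)
  also have "\<alpha> + \<beta> = level ?a ?c p" using ac level_combination[of ?a ?c] p(3) by simp
  finally show ?thesis .
qed

section \<open>Star regions and caps\<close>

text \<open>The region between the origin and a chain.\<close>

definition star :: "point list \<Rightarrow> point set" where
  "star L = {p \<in> wedge (hd L) (last L). chain_level L p \<le> 1}"

text \<open>The region between a lower chain \<open>A\<close> and an upper chain \<open>B\<close> with the same ends.\<close>

definition cap :: "point list \<Rightarrow> point list \<Rightarrow> point set" where
  "cap A B = {p \<in> wedge (hd A) (last A). 1 \<le> chain_level A p \<and> chain_level B p \<le> 1}"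

lemma chain_level_zero:
  assumes "fan L" "2 \<le> length L"
  shows "chain_level L 0 = 0"
  using chain_level_scale[OF assms, of 0 0] by (simp add: wedge_def)

lemma convex_between:
  assumes "convex H" "s *\<^sub>R p \<in> H" "t *\<^sub>R p \<in> H" "s \<le> 1" "1 \<le> (t::real)"
  shows "p \<in> H"
proof (cases "s = 1 \<or> t = 1")
  case True
  then show ?thesis using assms by auto
next
  case False
  then have st: "s < 1" "1 < t" using assms by auto
  \<comment> \<open>the weight for which the combination of \<open>s\<close> and \<open>t\<close> is 1\<close>
  define l where "l = (t - 1) / (t - s)"
  have "l * (t - s) = t - 1" using st by (simp add: l_def)
  then have "l * s + (1 - l) * t = 1" by (simp add: algebra_simps)
  moreover have "0 \<le> l" "0 \<le> 1 - l" using st by (auto simp: l_def field_simps)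
  ultimately have l: "0 \<le> l" "0 \<le> 1 - l" "l * s + (1 - l) * t = 1" by auto
  have "l *\<^sub>R (s *\<^sub>R p) + (1 - l) *\<^sub>R (t *\<^sub>R p) \<in> H"
    using convexD[OF assms(1-3), of l "1 - l"] l by simp
  also have "l *\<^sub>R (s *\<^sub>R p) + (1 - l) *\<^sub>R (t *\<^sub>R p) = (l * s + (1 - l) * t) *\<^sub>R p"
    by (simp add: scaleR_left_distrib)
  finally show ?thesis using l by simp
qed

lemma chain_level_normalize:
  assumes "fan L" "2 \<le> length L" "p \<in> wedge (hd L) (last L)" "p \<noteq> 0"
  shows "0 < chain_level L p" "(1 / chain_level L p) *\<^sub>R p \<in> convex hull (set L)"
proof -
  obtain u v \<alpha> \<beta> where h: "(u, v) \<in> edges L" "0 \<le> \<alpha>" "0 \<le> \<beta>"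
    "p = \<alpha> *\<^sub>R u + \<beta> *\<^sub>R v" "chain_level L p = \<alpha> + \<beta>" using fan_polar[OF assms(1-3)] by metis
  have "\<alpha> + \<beta> \<noteq> 0" 
  proof
    assume "\<alpha> + \<beta> = 0"
    then have "\<alpha> = 0" "\<beta> = 0" using h(2,3) by linarith+
    then show False using h(4) assms(4) by simp
  qed
  then show pos: "0 < chain_level L p" using h by linarith
  have "u \<in> set L" "v \<in> set L" using edges_set[OF h(1)] by (cases L; auto)+
  then have uv: "u \<in> convex hull (set L)" "v \<in> convex hull (set L)" by (auto intro: hull_inc)
  have "(\<alpha> / (\<alpha> + \<beta>)) *\<^sub>R u + (\<beta> / (\<alpha> + \<beta>)) *\<^sub>R v \<in> convex hull (set L)"
    using h pos by (intro convexD[OF convex_convex_hull uv]) (auto simp: add_divide_distrib [symmetric])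
  then show "(1 / chain_level L p) *\<^sub>R p \<in> convex hull (set L)"
    using h by (simp add: scaleR_add_right)
qed

text \<open>The sublevel set of a convex function is convex. Conversely, a point of it lies on the segment
  from the origin to the point where its ray meets the chain.\<close>

lemma star_eq_hull:
  assumes "bends 1 L" "fan L" "2 \<le> length L"
  shows "star L = convex hull (insert 0 (set L))"
proof
  have "convex (star L)"
  proof (rule convexI)
    fix x y and u v :: real
    assume *: "x \<in> star L" "y \<in> star L" "0 \<le> u" "0 \<le> v" "u + v = 1"
    then have "chain_level L (u *\<^sub>R x + v *\<^sub>R y) \<le> u * chain_level L x + v * chain_level L y"
      using chain_level_convexity[OF assms, of u v x y] by (simp add: star_def)
    also have "\<dots> \<le> u * 1 + v * 1" using * by (intro add_mono mult_left_mono) (auto simp: star_def)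
    finally show "u *\<^sub>R x + v *\<^sub>R y \<in> star L" using * wedge_combine by (auto simp: star_def)
  qed
  moreover have "0 \<in> star L"
    using chain_level_zero[OF assms(2,3)] by (simp add: star_def wedge_def)
  moreover have "set L \<subseteq> star L"
    using fan_set_wedge[OF assms(2,3)] chain_level_vertex[OF assms(2,3)] by (auto simp: star_def)
  ultimately show "convex hull (insert 0 (set L)) \<subseteq> star L" by (intro hull_minimal) auto
  show "star L \<subseteq> convex hull (insert 0 (set L))"
  proof
    fix p assume p: "p \<in> star L"
    show "p \<in> convex hull (insert 0 (set L))"
    proof (cases "p = 0")
      case True
      then show ?thesis by (simp add: hull_inc)
    next
      case False
      have w: "p \<in> wedge (hd L) (last L)" and le: "chain_level L p \<le> 1" using p by (auto simp: star_def)
      note n = chain_level_normalize[OF assms(2,3) w False]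
      have "(1 / chain_level L p) *\<^sub>R p \<in> convex hull (insert 0 (set L))"
        using n(2) hull_mono[of "set L" "insert 0 (set L)" convex] by auto
      moreover have "0 *\<^sub>R p \<in> convex hull (insert 0 (set L))" by (simp add: hull_inc)
      ultimately show ?thesis
        using convex_between[OF convex_convex_hull, of 0 p _ "1 / chain_level L p"] n(1) le by simp
    qed
  qed
qed

lemma valley_above_peak:
  assumes "bends (-1) A" "bends 1 B" "fan A" "fan B" "2 \<le> length A" "2 \<le> length B"
    and "hd A = hd B" "last A = last B" "p \<in> wedge (hd A) (last A)"
  shows "chain_level B p \<le> chain_level A p"
  using chain_level_vs_chord[of "-1" A p] chain_level_vs_chord[of 1 B p] assms by simp

text \<open>A cap is cut out by a concave function being at least 1 and a convex function being at most 1.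
  Conversely, a point of it lies between the points where its ray meets the two chains.\<close>

lemma cap_eq_hull:
  assumes "bends (-1) A" "bends 1 B" "fan A" "fan B" "2 \<le> length A" "2 \<le> length B"
    and hl: "hd A = hd B" "last A = last B"
  shows "cap A B = convex hull (set A \<union> set B)"
proof
  have "convex (cap A B)"
  proof (rule convexI)
    fix x y and u v :: real
    assume *: "x \<in> cap A B" "y \<in> cap A B" "0 \<le> u" "0 \<le> v" "u + v = 1"
    have wA: "x \<in> wedge (hd A) (last A)" "y \<in> wedge (hd A) (last A)" using * by (auto simp: cap_def)
    have "chain_level B (u *\<^sub>R x + v *\<^sub>R y) \<le> u * chain_level B x + v * chain_level B y"
      using chain_level_convexity[of 1 B u v x y] assms * wA by simp
    also have "\<dots> \<le> u * 1 + v * 1" using * by (intro add_mono mult_left_mono) (auto simp: cap_def)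
    finally have 1: "chain_level B (u *\<^sub>R x + v *\<^sub>R y) \<le> 1" using * by simp
    have "u * 1 + v * 1 \<le> u * chain_level A x + v * chain_level A y"
      using * by (intro add_mono mult_left_mono) (auto simp: cap_def)
    also have "\<dots> \<le> chain_level A (u *\<^sub>R x + v *\<^sub>R y)"
      using chain_level_convexity[of "-1" A u v x y] assms * wA by simp
    finally show "u *\<^sub>R x + v *\<^sub>R y \<in> cap A B" using 1 * wA wedge_combine by (auto simp: cap_def)
  qed
  moreover have "set A \<union> set B \<subseteq> cap A B"
  proof
    fix x assume x: "x \<in> set A \<union> set B"
    then have w: "x \<in> wedge (hd A) (last A)"
      using fan_set_wedge[OF assms(3,5), of x] fan_set_wedge[OF assms(4,6), of x] hl by auto
    have "chain_level B x \<le> chain_level A x" using valley_above_peak[OF assms w] .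
    moreover have "chain_level A x = 1 \<or> chain_level B x = 1" using x chain_level_vertex[OF assms(3,5)] chain_level_vertex[OF assms(4,6)] by blast
    ultimately show "x \<in> cap A B" using w by (auto simp: cap_def)
  qed
  ultimately show "convex hull (set A \<union> set B) \<subseteq> cap A B" by (intro hull_minimal) auto
  show "cap A B \<subseteq> convex hull (set A \<union> set B)"
  proof
    fix p assume p: "p \<in> cap A B"
    have w: "p \<in> wedge (hd A) (last A)" and le: "1 \<le> chain_level A p" "chain_level B p \<le> 1"
      using p by (auto simp: cap_def)
    have "p \<noteq> 0" using chain_level_scale[OF assms(3,5) w, of 0] le by auto
    note nA = chain_level_normalize[OF assms(3,5) w this]
    have wB: "p \<in> wedge (hd B) (last B)" using w hl by simp
    note nB = chain_level_normalize[OF assms(4,6) wB \<open>p \<noteq> 0\<close>]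
    have "convex hull (set A) \<subseteq> convex hull (set A \<union> set B)" "convex hull (set B) \<subseteq> convex hull (set A \<union> set B)"
      by (auto intro!: hull_mono)
    then show "p \<in> convex hull (set A \<union> set B)"
      using convex_between[OF convex_convex_hull, of "1 / chain_level A p" p _ "1 / chain_level B p"] nA nB le
      by auto
  qed
qed

lemma chain_level_replace_le:
  assumes "bends (-1) A" "bends 1 B" "fan (xs @ A @ ys)" "fan (xs @ B @ ys)" "2 \<le> length A" "2 \<le> length B"
    and hl: "hd A = hd B" "last A = last B" and p: "p \<in> wedge (hd (xs @ A @ ys)) (last (xs @ A @ ys))"
  shows "chain_level (xs @ B @ ys) p \<le> chain_level (xs @ A @ ys) p"
proof (cases "p \<in> wedge (hd A) (last A)")
  case True
  have "fan A" "fan B" using assms by (auto simp: fan_append)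
  then show ?thesis
    using chain_level_inside[OF assms(3,5) True] chain_level_inside[OF assms(4,6), of p]
      valley_above_peak[OF assms(1,2) _ _ assms(5,6) hl True] True hl by simp
next
  case False
  then show ?thesis using chain_level_outside[OF assms(3,4) _ _ hl p] assms(5,6) by force
qed

lemma hd_last_replace:
  assumes "A \<noteq> []" "B \<noteq> []" "hd A = hd B" "last A = last B"
  shows "hd (xs @ A @ ys) = hd (xs @ B @ ys)" "last (xs @ A @ ys) = last (xs @ B @ ys)"
  using assms by (auto simp: hd_append last_append)

lemma wedge_sublist:
  assumes "fan (xs @ A @ ys)" "2 \<le> length A"
  shows "wedge (hd A) (last A) \<subseteq> wedge (hd (xs @ A @ ys)) (last (xs @ A @ ys))"
proof
  fix p assume p: "p \<in> wedge (hd A) (last A)"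
  have "fan A" using assms by (simp add: fan_append)
  have "0 < cross (hd A) (last A)" using fan_ends[OF \<open>fan A\<close> assms(2)] .
  then obtain \<alpha> \<beta> where p: "0 \<le> \<alpha>" "0 \<le> \<beta>" "p = \<alpha> *\<^sub>R hd A + \<beta> *\<^sub>R last A"
    using wedge_cases[OF p] by metis
  have len: "2 \<le> length (xs @ A @ ys)" and ne: "A \<noteq> []" using assms by auto
  have "hd A \<in> wedge (hd (xs @ A @ ys)) (last (xs @ A @ ys))"
    "last A \<in> wedge (hd (xs @ A @ ys)) (last (xs @ A @ ys))"
    using fan_set_wedge[OF assms(1) len, of "hd A"] fan_set_wedge[OF assms(1) len, of "last A"] ne by auto
  then show "p \<in> wedge (hd (xs @ A @ ys)) (last (xs @ A @ ys))"
    unfolding p(3) using p(1,2) by (intro wedge_combine)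
qed

text \<open>The step from one chain to the next: a single convex cell fills the gap between them.\<close>

lemma star_replace:
  assumes "bends (-1) A" "bends 1 B" "fan (xs @ A @ ys)" "fan (xs @ B @ ys)" "2 \<le> length A" "2 \<le> length B"
    and hl: "hd A = hd B" "last A = last B"
  shows "star (xs @ B @ ys) = star (xs @ A @ ys) \<union> cap A B"
proof -
  have ne: "A \<noteq> []" "B \<noteq> []" using assms by auto
  note e = hd_last_replace[OF ne hl, of xs ys]
  have fAB: "fan A" "fan B" using assms by (auto simp: fan_append)
  note sub = wedge_sublist[OF assms(3,5)]
  show ?thesis
  proof (intro subset_antisym subsetI)
    fix p assume "p \<in> star (xs @ B @ ys)"
    then have p: "p \<in> wedge (hd (xs @ A @ ys)) (last (xs @ A @ ys))" "chain_level (xs @ B @ ys) p \<le> 1"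
      by (auto simp: star_def e)
    show "p \<in> star (xs @ A @ ys) \<union> cap A B"
    proof (cases "p \<in> wedge (hd A) (last A)")
      case True
      then have "chain_level (xs @ B @ ys) p = chain_level B p" "chain_level (xs @ A @ ys) p = chain_level A p"
        using chain_level_inside[OF assms(3,5) True] chain_level_inside[OF assms(4,6), of p] True hl by auto
      then show ?thesis using p True by (auto simp: star_def cap_def)
    next
      case False
      then show ?thesis using p chain_level_outside[OF assms(3,4) ne hl p(1)] by (auto simp: star_def)
    qed
  next
    fix p assume "p \<in> star (xs @ A @ ys) \<union> cap A B"
    then show "p \<in> star (xs @ B @ ys)"
    proof
      assume p: "p \<in> star (xs @ A @ ys)"
      then show ?thesis
        using chain_level_replace_le[OF assms, of p] by (auto simp: star_def e)
    next
      assume p: "p \<in> cap A B"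
      then have "chain_level (xs @ B @ ys) p = chain_level B p"
        using chain_level_inside[OF assms(4,6)] hl by (simp add: cap_def)
      then show ?thesis using p sub by (auto simp: star_def cap_def e)
    qed
  qed
qed

section \<open>Tilings by cells\<close>

lemma interior_step:
  fixes x v :: "'a :: real_normed_vector"
  assumes "x \<in> interior S"
  obtains e :: real where "0 < e" "e < 1" "x + e *\<^sub>R v \<in> S"
proof -
  have "open ((\<lambda>t::real. x + t *\<^sub>R v) -` interior S)"
    by (intro open_vimage) (auto intro!: continuous_intros)
  moreover have "0 \<in> (\<lambda>t::real. x + t *\<^sub>R v) -` interior S" using assms by simp
  ultimately obtain d where d: "0 < d" "ball 0 d \<subseteq> (\<lambda>t::real. x + t *\<^sub>R v) -` interior S"
    by (meson open_contains_ball)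
  define e where "e = min (d / 2) (1 / 2)"
  have e: "0 < e" "e < 1" "e < d" using d(1) by (auto simp: e_def min_def)
  then have "e \<in> ball 0 d" by simp
  then have "x + e *\<^sub>R v \<in> interior S" using d(2) by blast
  then show thesis using that e interior_subset by blast
qed

text \<open>Levels are local, so on either side of the ray through \<open>b\<close> the level is that of the
  respective part of the chain. A point interior to both parts could be moved across this ray within
  the first part.\<close>

lemma star_split:
  assumes "fan (xs @ b # ys)" "xs \<noteq> []" "ys \<noteq> []"
  shows "star (xs @ b # ys) = star (xs @ [b]) \<union> star (b # ys)"
    and "interior (star (xs @ [b])) \<inter> interior (star (b # ys)) = {}"
proof -
  have len: "2 \<le> length (xs @ [b])" "2 \<le> length (b # ys)" using assms(2,3) by (auto simp: Suc_le_eq)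
  have f1: "fan ([] @ (xs @ [b]) @ ys)" and f2: "fan (xs @ (b # ys) @ [])" using assms(1) by auto
  note i1 = chain_level_inside[OF f1 len(1)] and i2 = chain_level_inside[OF f2 len(2)]
  note w1 = wedge_sublist[OF f1 len(1)] and w2 = wedge_sublist[OF f2 len(2)]
  show "star (xs @ b # ys) = star (xs @ [b]) \<union> star (b # ys)"
  proof (intro subset_antisym subsetI)
    fix p assume p: "p \<in> star (xs @ b # ys)"
    consider "cross b p \<le> 0" | "0 \<le> cross b p" by linarith
    then show "p \<in> star (xs @ [b]) \<union> star (b # ys)"
    proof cases
      case 1
      then have "p \<in> wedge (hd (xs @ [b])) (last (xs @ [b]))"
        using p assms(2) by (simp add: star_def wedge_def cross_swap[of p b])
      then show ?thesis using i1[of p] p by (auto simp: star_def)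
    next
      case 2
      then have "p \<in> wedge (hd (b # ys)) (last (b # ys))"
        using p assms(3) by (simp add: star_def wedge_def)
      then show ?thesis using i2[of p] p by (auto simp: star_def)
    qed
  next
    fix p assume "p \<in> star (xs @ [b]) \<union> star (b # ys)"
    then show "p \<in> star (xs @ b # ys)"
    proof
      assume p: "p \<in> star (xs @ [b])"
      then show ?thesis using i1[of p] w1 by (auto simp: star_def)
    next
      assume p: "p \<in> star (b # ys)"
      then show ?thesis using i2[of p] w2 by (auto simp: star_def)
    qed
  qed
  show "interior (star (xs @ [b])) \<inter> interior (star (b # ys)) = {}"
  proof (rule ccontr)
    assume "\<not> ?thesis"
    then obtain x where x: "x \<in> interior (star (xs @ [b]))" "x \<in> star (b # ys)"
      using interior_subset by blast
    obtain e where e: "0 < e" "x + e *\<^sub>R hd ys \<in> star (xs @ [b])" using interior_step[OF x(1)] by metis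
    have "0 < cross b (hd ys)" using assms(1,3) by (simp add: fan_append fan_Cons)
    then have "0 < e * cross b (hd ys)" using e(1) by simp
    moreover have "0 \<le> cross b x" using x(2) by (simp add: star_def wedge_def)
    moreover have "cross b (x + e *\<^sub>R hd ys) \<le> 0"
      using e(2) cross_swap[of b "x + e *\<^sub>R hd ys"] by (simp add: star_def wedge_def)
    ultimately show False by simp
  qed
qed

text \<open>A cell is given by any set of points that spans it; its vertices are then among these points, so
  no list of vertices in convex position has to be exhibited.\<close>

definition cell :: "point set \<Rightarrow> point set \<Rightarrow> bool" where
  "cell P K \<longleftrightarrow> (\<exists>S\<subseteq>P. K = convex hull S \<and> \<not> collinear S) \<and> interior K \<inter> P = {}"

text \<open>Only an upper bound on the number of cells is recorded, which makes unions of tilings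
  simple.\<close>

definition tiled :: "point set \<Rightarrow> point set \<Rightarrow> nat \<Rightarrow> bool" where
  "tiled P R k \<longleftrightarrow> (\<exists>D. finite D \<and> card D \<le> k \<and> (\<forall>K\<in>D. cell P K) \<and>
     pairwise (\<lambda>K L. disjnt (interior K) (interior L)) D \<and> \<Union>D = R)"

lemma tiled_cell: "cell P K \<Longrightarrow> tiled P K 1"
  unfolding tiled_def by (rule exI[of _ "{K}"]) auto

lemma tiled_union:
  assumes "tiled P A j" "tiled P B k" "interior A \<inter> interior B = {}"
  shows "tiled P (A \<union> B) (j + k)"
proof -
  obtain D where D: "finite D" "card D \<le> j" "\<forall>K\<in>D. cell P K"
    "pairwise (\<lambda>K L. disjnt (interior K) (interior L)) D" "\<Union>D = A" using assms(1) unfolding tiled_def by blast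
  obtain E where E: "finite E" "card E \<le> k" "\<forall>K\<in>E. cell P K"
    "pairwise (\<lambda>K L. disjnt (interior K) (interior L)) E" "\<Union>E = B" using assms(2) unfolding tiled_def by blast
  have dj: "disjnt (interior K) (interior L)" if "K \<in> D" "L \<in> E" for K L
  proof -
    have "interior K \<subseteq> interior A" "interior L \<subseteq> interior B" using that D(5) E(5) by (auto intro!: interior_mono)
    then show ?thesis using assms(3) by (auto simp: disjnt_def)
  qed
  have "pairwise (\<lambda>K L. disjnt (interior K) (interior L)) (D \<union> E)"
    using D(4) E(4) dj unfolding pairwise_def by (metis Un_iff disjnt_sym)
  moreover have "card (D \<union> E) \<le> j + k" using card_Un_le[of D E] D(2) E(2) by linarith
  ultimately show ?thesis unfolding tiled_def
    using D E by (intro exI[of _ "D \<union> E"]) auto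
qed

text \<open>The number of valleys of a chain, which are the reflex vertices of its star region.\<close>

fun reflexes :: "point list \<Rightarrow> nat" where
  "reflexes (a # b # c # L) = (if turn a b c < 0 then 1 else 0) + reflexes (b # c # L)"
| "reflexes _ = 0"

lemma reflexes_append: "reflexes (xs @ a # b # ys) = reflexes (xs @ [a, b]) + reflexes (a # b # ys)"
proof (induction xs)
  case (Cons x xs)
  then show ?case by (cases xs; cases "tl xs") auto
qed simp

lemma cross_zero_dependent:
  assumes "cross u v = 0" "u \<noteq> 0"
  shows "\<exists>k. v = k *\<^sub>R u"
proof -
  have "u $ 1 \<noteq> 0 \<or> u $ 2 \<noteq> 0" using assms(2) by (auto simp: vec_eq_iff forall_2)
  then show ?thesis
  proof
    assume "u $ 1 \<noteq> 0"
    then have "v = (v $ 1 / u $ 1) *\<^sub>R u" using assms(1) by (simp add: vec_eq_iff forall_2 cross_def field_simps)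
    then show ?thesis by blast
  next
    assume "u $ 2 \<noteq> 0"
    then have "v = (v $ 2 / u $ 2) *\<^sub>R u" using assms(1) by (simp add: vec_eq_iff forall_2 cross_def field_simps)
    then show ?thesis by blast
  qed
qed

lemma turn_zero_collinear:
  assumes "turn a b c = 0" "a \<noteq> b"
  shows "collinear {a, b, c}"
proof -
  have "cross (b - a) (c - a) = turn a b c" by (simp add: turn_def cross_def algebra_simps)
  then obtain k where "c - a = k *\<^sub>R (b - a)" using cross_zero_dependent[of "b - a" "c - a"] assms by auto
  then have "collinear {0, b - a, c - a}" by (auto simp: collinear_lemma)
  then show ?thesis using collinear_3[of b a c] by (simp add: insert_commute)
qed

text \<open>A point set seen from one of its points, the origin. Transitivity of the orientation holds when
  the origin is an extreme point of the convex hull: then the other points lie in an open half-plane.\<close>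

locale fan_points =
  fixes P :: "point set"
  assumes origin: "0 \<in> P"
    and general: "general_position P"
    and cross_trans: "\<lbrakk>u \<in> P - {0}; v \<in> P - {0}; w \<in> P - {0}; 0 < cross u v; 0 < cross v w\<rbrakk> \<Longrightarrow> 0 < cross u w"
begin

lemma turn_nonzero: "a \<in> P \<Longrightarrow> b \<in> P \<Longrightarrow> c \<in> P \<Longrightarrow> distinct [a, b, c] \<Longrightarrow> turn a b c \<noteq> 0"
  using turn_zero_collinear[of a b c] general by (auto simp: general_position_def)

lemma not_collinear:
  assumes "S \<subseteq> P" "a \<in> S" "b \<in> S" "c \<in> S" "distinct [a, b, c]"
  shows "\<not> collinear S"
  using general assms collinear_subset[of S "{a, b, c}"] by (auto simp: general_position_def subset_iff)

definition chain :: "point list \<Rightarrow> bool" where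
  "chain L \<longleftrightarrow> fan L \<and> set L \<subseteq> P - {0}"

lemma chain_distinct: "chain L \<Longrightarrow> distinct L"
proof (induction L)
  case (Cons a L)
  then have "\<forall>y\<in>set L. 0 < cross a y" "chain L" by (auto simp: chain_def fan_Cons)
  moreover from this have "a \<notin> set L" by force
  ultimately show ?case using Cons by simp
qed simp

lemma chain_join:
  assumes "chain U" "U \<noteq> []" "chain (last U # ws)"
  shows "chain (U @ ws)"
proof -
  obtain V z where U: "U = V @ [z]" using assms(2) by (metis rev_exhaust)
  have "0 < cross x w" if "x \<in> set V" "w \<in> set ws" for x w
    using cross_trans[of x z w] that assms unfolding U by (auto simp: chain_def fan_append fan_Cons)
  then show ?thesis using assms unfolding U by (auto simp: chain_def fan_append fan_Cons)
qed

section \<open>Climbing from chain to chain\<close>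

text \<open>\<open>climb L m U\<close> means that \<open>U\<close> arises from \<open>L\<close> by adding \<open>m\<close> caps. The relation only
  speaks of shapes; that caps contain no points inside is a condition on \<open>L\<close> and \<open>U\<close> alone,
  see \<open>tiled_climb\<close>. The total length 5 ensures that a cap has at least three vertices.\<close>

inductive climb :: "point list \<Rightarrow> nat \<Rightarrow> point list \<Rightarrow> bool" where
  refl: "chain L \<Longrightarrow> L \<noteq> [] \<Longrightarrow> climb L 0 L"
| step: "\<lbrakk>climb L m (xs @ A @ ys); chain (xs @ B @ ys); bends (-1) A; bends 1 B;
    2 \<le> length A; 2 \<le> length B; 5 \<le> length A + length B; hd A = hd B; last A = last B\<rbrakk>
    \<Longrightarrow> climb L (Suc m) (xs @ B @ ys)"

lemma climb_chain: "climb L m U \<Longrightarrow> chain L \<and> chain U \<and> L \<noteq> [] \<and> U \<noteq> [] \<and> hd L = hd U \<and> last L = last U"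
proof (induction rule: climb.induct)
  case (step L m xs A ys B)
  then have "A \<noteq> []" "B \<noteq> []" by auto
  then show ?case using step hd_last_replace[of A B xs ys] by auto
qed auto

lemma climb_length: "climb L m U \<Longrightarrow> 2 \<le> length L \<Longrightarrow> 2 \<le> length U"
  by (induction rule: climb.induct) auto

lemma climb_level:
  assumes "climb L m U" "p \<in> wedge (hd L) (last L)"
  shows "chain_level U p \<le> chain_level L p"
  using assms
proof (induction rule: climb.induct)
  case (step L m xs A ys B)
  have "fan (xs @ A @ ys)" "fan (xs @ B @ ys)" "p \<in> wedge (hd (xs @ A @ ys)) (last (xs @ A @ ys))"
    using climb_chain[OF step(1)] step by (auto simp: chain_def)
  then have "chain_level (xs @ B @ ys) p \<le> chain_level (xs @ A @ ys) p"
    by (intro chain_level_replace_le step)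
  then show ?case using step by fastforce
qed auto

lemma climb_star: "climb L m U \<Longrightarrow> star L \<subseteq> star U"
  using climb_level climb_chain by (fastforce simp: star_def)

lemma climb_extend:
  assumes "climb L m U" "chain (last L # ws)"
  shows "climb (L @ ws) m (U @ ws)"
  using assms
proof (induction rule: climb.induct)
  case (refl L)
  then show ?case by (auto intro: climb.refl chain_join)
next
  case (step L m xs A ys B)
  have ne: "xs @ B @ ys \<noteq> []" using step by auto
  have "A \<noteq> []" "B \<noteq> []" using step(5,6) by auto
  then have "last (xs @ B @ ys) = last L" using climb_chain[OF step(1)] hd_last_replace(2)[of A B xs ys] step(8,9) by metis
  then have "chain (xs @ B @ ys @ ws)" using chain_join[OF step(2) ne, of ws] step by simp
  then have "climb (L @ ws) (Suc m) (xs @ B @ ys @ ws)"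
    using step by (intro climb.step[of _ _ xs A]) auto
  then show ?case by simp
qed

text \<open>Interior points of a region can be moved a little along their ray in both directions. A point
  on or below the lower chain leaves the cap when it is moved towards the origin, a point on or above
  the upper chain leaves it when it is moved away, so neither lies in the interior of the cap. The
  same argument separates the cap from the star region.\<close>

lemma tiled_replace:
  assumes tiled: "tiled P (star (xs @ A @ ys)) k"
    and A: "bends (-1) A" "2 \<le> length A" and B: "bends 1 B" "2 \<le> length B"
    and chains: "chain (xs @ A @ ys)" "chain (xs @ B @ ys)"
    and hl: "hd A = hd B" "last A = last B" and len: "5 \<le> length A + length B"
    and above: "\<And>p. p \<in> P - {0} \<Longrightarrow> p \<in> wedge (hd A) (last A) \<Longrightarrow>
      chain_level (xs @ A @ ys) p \<le> 1 \<or> 1 \<le> chain_level (xs @ B @ ys) p"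
  shows "tiled P (star (xs @ B @ ys)) (Suc k)"
proof -
  have fA: "fan (xs @ A @ ys)" and fB: "fan (xs @ B @ ys)" using chains by (auto simp: chain_def)
  then have f: "fan A" "fan B" by (auto simp: fan_append)
  have AB: "set A \<union> set B \<subseteq> P" "distinct A" "distinct B"
    using chains chain_distinct[OF chains(1)] chain_distinct[OF chains(2)] by (auto simp: chain_def)
  have wB: "wedge (hd B) (last B) = wedge (hd A) (last A)" using hl by simp
  have K: "cap A B = convex hull (set A \<union> set B)" using cap_eq_hull assms f by blast
  have "\<not> collinear (set A \<union> set B)"
  proof -
    have "3 \<le> length A \<or> 3 \<le> length B" using len by linarith
    then obtain C where C: "C \<in> {A, B}" "3 \<le> length C" by blast
    then obtain a b c C' where "C = a # b # c # C'"
      by (metis Suc_le_length_iff numeral_3_eq_3)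
    then show ?thesis using C AB by (intro not_collinear[OF AB(1), of a b c]) auto
  qed
  moreover have "interior (cap A B) \<inter> P = {}"
  proof (rule ccontr)
    assume "\<not> ?thesis"
    then obtain p where p: "p \<in> interior (cap A B)" "p \<in> P" by blast
    then have pc: "p \<in> cap A B" using interior_subset by blast
    then have w: "p \<in> wedge (hd A) (last A)" by (simp add: cap_def)
    have "p \<noteq> 0" using pc chain_level_zero[OF f(1) A(2)] by (auto simp: cap_def)
    then consider "chain_level A p \<le> 1" | "1 \<le> chain_level B p"
      using above[of p] p w chain_level_inside[OF fA A(2), of p] chain_level_inside[OF fB B(2), of p] wB by auto
    then show False
    proof cases
      case 1
      obtain e where e: "0 < e" "e < 1" "p + e *\<^sub>R (- p) \<in> cap A B" using interior_step[OF p(1)] by metis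
      have "p + e *\<^sub>R (- p) = (1 - e) *\<^sub>R p" by (simp add: scaleR_left_diff_distrib)
      then have "1 \<le> (1 - e) * chain_level A p"
        using e chain_level_scale[OF f(1) A(2) w, of "1 - e"] by (simp add: cap_def)
      also have "\<dots> \<le> (1 - e) * 1" using 1 e by (intro mult_left_mono) auto
      finally show False using e by simp
    next
      case 2
      obtain e where e: "0 < e" "e < 1" "p + e *\<^sub>R p \<in> cap A B" using interior_step[OF p(1)] by metis
      have "p + e *\<^sub>R p = (1 + e) *\<^sub>R p" by (simp add: scaleR_left_distrib)
      then have "(1 + e) * chain_level B p \<le> 1"
        using e chain_level_scale[OF f(2) B(2), of p "1 + e"] w wB by (simp add: cap_def)
      moreover have "(1 + e) * 1 \<le> (1 + e) * chain_level B p" using 2 e by (intro mult_left_mono) auto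
      ultimately have "(1 + e) * 1 \<le> 1" by (rule order_trans[rotated])
      then show False using e by simp
    qed
  qed
  ultimately have "cell P (cap A B)" unfolding cell_def using K AB by blast
  moreover have "interior (star (xs @ A @ ys)) \<inter> interior (cap A B) = {}"
  proof (rule ccontr)
    assume "\<not> ?thesis"
    then obtain p where p: "p \<in> interior (star (xs @ A @ ys))" "p \<in> cap A B" using interior_subset by blast
    then have w: "p \<in> wedge (hd A) (last A)" "1 \<le> chain_level A p" by (auto simp: cap_def)
    obtain e where e: "0 < e" "e < 1" "p + e *\<^sub>R p \<in> star (xs @ A @ ys)" using interior_step[OF p(1)] by metis
    have eq: "p + e *\<^sub>R p = (1 + e) *\<^sub>R p" by (simp add: scaleR_left_distrib)
    have we: "(1 + e) *\<^sub>R p \<in> wedge (hd A) (last A)" using w e by (intro wedge_scale) auto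
    have "chain_level (xs @ A @ ys) ((1 + e) *\<^sub>R p) = (1 + e) * chain_level A p"
      using chain_level_inside[OF fA A(2) we] chain_level_scale[OF f(1) A(2) w(1)] e by simp
    moreover have "(1 + e) * 1 \<le> (1 + e) * chain_level A p" using w e by (intro mult_left_mono) auto
    moreover have "chain_level (xs @ A @ ys) ((1 + e) *\<^sub>R p) \<le> 1" using e(3) eq by (simp add: star_def)
    ultimately have "(1 + e) * 1 \<le> 1" by linarith
    then show False using e by simp
  qed
  ultimately have "tiled P (star (xs @ A @ ys) \<union> cap A B) (k + 1)"
    using tiled_union[OF tiled tiled_cell] by blast
  then show ?thesis using star_replace[OF A(1) B(1) fA fB A(2) B(2) hl] by simp
qed

text \<open>Levels decrease during a climb. So a point that lies below the first chain lies below all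
  chains, and a point that lies above the last chain lies above all chains; in both cases no cap
  has it in its interior.\<close>

lemma tiled_climb:
  assumes "climb L m U" "2 \<le> length L" "tiled P (star L) k"
    and "\<And>p. p \<in> P - {0} \<Longrightarrow> p \<in> wedge (hd L) (last L) \<Longrightarrow> chain_level L p \<le> 1 \<or> 1 \<le> chain_level U p"
  shows "tiled P (star U) (k + m)"
  using assms
proof (induction rule: climb.induct)
  case (step L m xs A ys B)
  note c = climb_chain[OF step(1)]
  have fA: "fan (xs @ A @ ys)" and fB: "fan (xs @ B @ ys)" using c step(2) by (auto simp: chain_def)
  have key: "chain_level L p \<le> 1 \<or> 1 \<le> chain_level (xs @ A @ ys) p \<and> 1 \<le> chain_level (xs @ B @ ys) p"
    if "p \<in> P - {0}" "p \<in> wedge (hd L) (last L)" for p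
    using step(13)[OF that] chain_level_replace_le[OF step(3,4) fA fB step(5,6,8,9), of p] that c by auto
  have "tiled P (star (xs @ A @ ys)) (k + m)" using step.IH step(11,12) key by blast
  then have "tiled P (star (xs @ B @ ys)) (Suc (k + m))"
  proof (rule tiled_replace[OF _ step(3,5,4,6) _ step(2,8,9,7)])
    fix p assume p: "p \<in> P - {0}" "p \<in> wedge (hd A) (last A)"
    have "p \<in> wedge (hd L) (last L)" using wedge_sublist[OF fA step(5)] p c by auto
    then show "chain_level (xs @ A @ ys) p \<le> 1 \<or> 1 \<le> chain_level (xs @ B @ ys) p"
      using key[OF p(1)] climb_level[OF step(1), of p] by fastforce
  qed (use c in auto)
  then show ?case by simp
qed auto

lemma reflex_exists:
  assumes "chain L" "\<not> bends 1 L"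
  obtains xs a b c ys where "L = xs @ a # b # c # ys" "turn a b c < 0"
proof -
  have "\<exists>xs a b c ys. L = xs @ a # b # c # ys \<and> turn a b c < 0"
    using assms
  proof (induction "1::real" L rule: bends.induct)
    case (1 a b c L)
    show ?case
    proof (cases "turn a b c < 0")
      case True
      then show ?thesis by (metis append_Nil)
    next
      case False
      have "turn a b c \<noteq> 0" using 1(2) chain_distinct[OF 1(2)] by (intro turn_nonzero) (auto simp: chain_def)
      then have "\<not> bends 1 (b # c # L)" using 1(3) False by auto
      moreover have "chain (b # c # L)" using 1(2) by (auto simp: chain_def fan_Cons)
      ultimately show ?thesis using 1(1) by (metis append_Cons)
    qed
  qed auto
  then show thesis using that by blast
qed

text \<open>Cutting along the segments from the origin to the valleys leaves pieces without valleys, which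
  are convex.\<close>

lemma tiled_star:
  assumes "chain L" "2 \<le> length L"
    and "\<And>p. p \<in> P - {0} \<Longrightarrow> p \<in> wedge (hd L) (last L) \<Longrightarrow> 1 \<le> chain_level L p"
  shows "tiled P (star L) (Suc (reflexes L))"
  using assms
proof (induction "length L" arbitrary: L rule: less_induct)
  case less
  have f: "fan L" using less(2) by (simp add: chain_def)
  show ?case
  proof (cases "bends 1 L")
    case True
    obtain a b L' where L: "L = a # b # L'" using less(3) by (metis Suc_le_length_iff numeral_2_eq_2)
    have hull: "star L = convex hull (insert 0 (set L))" using star_eq_hull True f less(3) by blast
    have sub: "insert 0 (set L) \<subseteq> P" using less(2) origin by (auto simp: chain_def)
    have "distinct [0, a, b]" using less(2) chain_distinct[OF less(2)] L by (auto simp: chain_def)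
    then have nc: "\<not> collinear (insert 0 (set L))" using L by (intro not_collinear[OF sub, of 0 a b]) auto
    have "interior (star L) \<inter> P = {}"
    proof (rule ccontr)
      assume "\<not> ?thesis"
      then obtain p where p: "p \<in> interior (star L)" "p \<in> P" by blast
      then have w: "p \<in> wedge (hd L) (last L)" using interior_subset by (auto simp: star_def)
      show False
      proof (cases "p = 0")
        case True
        \<comment> \<open>the origin is on the boundary: moving against the last point leaves the wedge\<close>
        obtain e where e: "0 < e" "p + e *\<^sub>R (- last L) \<in> star L" using interior_step[OF p(1)] by metis
        have "0 < e * cross (hd L) (last L)" using fan_ends[OF f less(3)] e by simp
        then show False using e True cross_simps(4)[of "hd L" "- e" "last L"] by (simp add: star_def wedge_def)
      next
        case False
        obtain e where e: "0 < e" "e < 1" "p + e *\<^sub>R p \<in> star L" using interior_step[OF p(1)] by metis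
        have "p + e *\<^sub>R p = (1 + e) *\<^sub>R p" by (simp add: scaleR_left_distrib)
        then have "(1 + e) * chain_level L p \<le> 1"
          using e chain_level_scale[OF f less(3) w, of "1 + e"] by (simp add: star_def)
        moreover have "(1 + e) * 1 \<le> (1 + e) * chain_level L p"
          using less(4)[of p] w p(2) False e by (intro mult_left_mono) auto
        ultimately have "(1 + e) * 1 \<le> 1" by (rule order_trans[rotated])
        then show False using e by simp
      qed
    qed
    then have "cell P (star L)" unfolding cell_def using hull sub nc by blast
    then have "tiled P (star L) 1" by (rule tiled_cell)
    then show ?thesis unfolding tiled_def by fastforce
  next
    case False
    obtain xs a b c ys where L: "L = xs @ a # b # c # ys" and t: "turn a b c < 0"
      using reflex_exists[OF less(2) False] .
    define X Y where "X = xs @ [a, b]" and "Y = b # c # ys"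
    have split: "star L = star X \<union> star Y" "interior (star X) \<inter> interior (star Y) = {}"
      using star_split[of "xs @ [a]" b "c # ys"] f L by (auto simp: X_def Y_def)
    have fX: "fan ([] @ X @ c # ys)" and fY: "fan ((xs @ [a]) @ Y @ [])" using f L by (auto simp: X_def Y_def)
    have len: "2 \<le> length X" "2 \<le> length Y" by (auto simp: X_def Y_def)
    have "chain X" "chain Y" using less(2) L by (auto simp: chain_def X_def Y_def fan_append fan_Cons)
    moreover have "1 \<le> chain_level X p" if "p \<in> P - {0}" "p \<in> wedge (hd X) (last X)" for p
      using less(4)[OF that(1)] chain_level_inside[OF fX len(1) that(2)] wedge_sublist[OF fX len(1)] that(2)
      by (auto simp: L X_def)
    moreover have "1 \<le> chain_level Y p" if "p \<in> P - {0}" "p \<in> wedge (hd Y) (last Y)" for p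
      using less(4)[OF that(1)] chain_level_inside[OF fY len(2) that(2)] wedge_sublist[OF fY len(2)] that(2)
      by (auto simp: L Y_def)
    moreover have "length X < length L" "length Y < length L" by (auto simp: L X_def Y_def)
    ultimately have "tiled P (star X) (Suc (reflexes X))" "tiled P (star Y) (Suc (reflexes Y))"
      using less(1) len by blast+
    then have "tiled P (star L) (Suc (reflexes X) + Suc (reflexes Y))" using tiled_union split by metis
    moreover have "reflexes L = reflexes X + Suc (reflexes Y)"
      using reflexes_append[of xs a b "c # ys"] t by (simp add: L X_def Y_def)
    ultimately show ?thesis by simp
  qed
qed

text \<open>Capping a valley with a triangle removes one vertex of the chain. Without valleys the star region
  is convex and contains all points, so it is the convex hull. At least two vertices remain on the
  chain.\<close>

lemma tiled_hull:
  assumes "tiled P (star U) k" "chain U" "2 \<le> length U" "P \<subseteq> star U"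
  shows "tiled P (convex hull P) (k + (length U - 2))"
  using assms
proof (induction "length U" arbitrary: U k rule: less_induct)
  case less
  have f: "fan U" using less(3) by (simp add: chain_def)
  show ?case
  proof (cases "bends 1 U")
    case True
    have s: "star U = convex hull (insert 0 (set U))" using star_eq_hull True f less(4) by blast
    have "convex hull (insert 0 (set U)) \<subseteq> convex hull P"
      using less(3) origin by (intro hull_mono) (auto simp: chain_def)
    moreover have "convex hull P \<subseteq> star U" using less(5) s by (metis convex_convex_hull hull_minimal)
    ultimately have "star U = convex hull P" using s by blast
    then show ?thesis using less(2) unfolding tiled_def by (metis trans_le_add1)
  next
    case False
    obtain xs a b c ys where U: "U = xs @ a # b # c # ys" and t: "turn a b c < 0"
      using reflex_exists[OF less(3) False] .
    define V where "V = xs @ [a, c] @ ys"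
    have U': "U = xs @ [a, b, c] @ ys" using U by simp
    have cV: "chain V" using less(3) by (auto simp: U V_def chain_def fan_append fan_Cons)
    have "climb U 0 (xs @ [a, b, c] @ ys)" using climb.refl[OF less(3)] U by auto
    then have "climb U (Suc 0) (xs @ [a, c] @ ys)"
      by (rule climb.step) (use cV t in \<open>auto simp: V_def\<close>)
    then have cl: "climb U 1 V" by (simp add: V_def)
    have "tiled P (star V) (k + 1)"
      by (rule tiled_climb[OF cl less(4,2)]) (use less(5) in \<open>auto simp: star_def\<close>)
    moreover have "P \<subseteq> star V" using climb_star[OF cl] less(5) by blast
    moreover have "length V < length U" "2 \<le> length V" by (auto simp: U V_def)
    ultimately have "tiled P (convex hull P) (k + 1 + (length V - 2))" using less(1) cV by blast
    moreover have "k + 1 + (length V - 2) = k + (length U - 2)" by (simp add: U V_def)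
    ultimately show ?thesis by metis
  qed
qed

end

section \<open>The chain of peaks\<close>

text \<open>Appending to a chain adds a turn at its last vertex, which depends on the last two vertices of the
  old chain. Chains of length one, which have no turn yet, are covered by truncated subtraction.\<close>

definition last_two :: "'a list \<Rightarrow> 'a list" where
  "last_two L = drop (length L - 2) L"

lemma last_two_long: "2 \<le> length zs \<Longrightarrow> last_two (L @ zs) = last_two zs"
  by (simp add: last_two_def)

lemma last_two_pair [simp]: "last_two (L @ [a, b]) = [a, b]" "last_two [a, b] = [a, b]" "last_two [a] = [a]"
  "last_two (c # L @ [a, b]) = [a, b]"
  by (simp_all add: last_two_def)

lemma last_two_cases:
  assumes "2 \<le> length L"
  obtains L' a b where "L = L' @ [a, b]"
proof -
  obtain M b where M: "L = M @ [b]" using assms by (cases L rule: rev_cases) auto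
  then obtain L' a where "M = L' @ [a]" using assms by (cases M rule: rev_cases) auto
  then show thesis using that M by simp
qed

lemma last_two_append: "last_two (L @ zs) = last_two (last_two L @ zs)"
proof (cases "2 \<le> length L")
  case True
  then obtain L' a b where L: "L = L' @ [a, b]" using last_two_cases by metis
  then show ?thesis using last_two_long[of "[a, b] @ zs" L'] by simp
qed (simp add: last_two_def)

lemma bends_append: "bends \<sigma> (xs @ a # b # ys) \<longleftrightarrow> bends \<sigma> (xs @ [a, b]) \<and> bends \<sigma> (a # b # ys)"
proof (induction xs)
  case (Cons x xs)
  then show ?case by (cases xs; cases "tl xs") auto
qed simp

lemma bends_tl: "bends \<sigma> (x # L) \<Longrightarrow> bends \<sigma> L"
  by (cases "(\<sigma>, x # L)" rule: bends.cases) auto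

lemma bends_butlast: "bends \<sigma> (L @ [x]) \<Longrightarrow> bends \<sigma> L"
proof (cases "2 \<le> length L")
  case True
  assume "bends \<sigma> (L @ [x])"
  moreover obtain L' a b where "L = L' @ [a, b]" using last_two_cases True by metis
  ultimately show ?thesis using bends_append[of \<sigma> L' a b "[x]"] by simp
next
  case False
  then show ?thesis by (cases L) (auto simp: Suc_le_eq)
qed

lemma bends_snoc: "bends \<sigma> L \<Longrightarrow> bends \<sigma> (last_two L @ [x]) \<Longrightarrow> bends \<sigma> (L @ [x])"
proof (cases "2 \<le> length L")
  case True
  assume "bends \<sigma> L" "bends \<sigma> (last_two L @ [x])"
  moreover obtain L' a b where "L = L' @ [a, b]" using last_two_cases True by metis
  ultimately show ?thesis using bends_append[of \<sigma> L' a b "[x]"] by simp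
next
  case False
  then have "last_two L = L" by (simp add: last_two_def)
  then show "bends \<sigma> (last_two L @ [x]) \<Longrightarrow> bends \<sigma> (L @ [x])" by simp
qed

lemma reflexes_snoc: "reflexes (L @ zs) = reflexes L + reflexes (last_two L @ zs)"
proof (cases "2 \<le> length L")
  case True
  then obtain L' a b where "L = L' @ [a, b]" using last_two_cases by metis
  then show ?thesis using reflexes_append[of L' a b zs] by simp
next
  case False
  then have "last_two L = L" "reflexes L = 0" by (cases L; auto simp: last_two_def Suc_le_eq)+
  then show ?thesis by simp
qed

lemma reflexes_valley: "bends (-1) L \<Longrightarrow> reflexes L = length L - 2"
  by (induction L rule: reflexes.induct) auto

lemma reflexes_peak: "bends 1 L \<Longrightarrow> reflexes L = 0"
  by (induction L rule: reflexes.induct) auto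

lemma reflexes_after_peak:
  assumes "Q \<noteq> []" "bends 1 (last_two Q @ [z])" "bends (-1) (last Q # z # zs)"
  shows "reflexes (last_two Q @ z # zs) = length zs"
proof (cases "2 \<le> length Q")
  case True
  then obtain Q' a b where Q: "Q = Q' @ [a, b]" using last_two_cases by metis
  then show ?thesis using assms reflexes_valley[of "b # z # zs"] by simp
next
  case False
  then obtain a where "Q = [a]" using assms(1) by (cases Q) (auto simp: Suc_le_eq)
  then show ?thesis using assms reflexes_valley[of "a # z # zs"] by simp
qed

text \<open>\<open>peak_chain Q N\<close> means that \<open>N\<close> consists of the peaks of \<open>Q\<close> and its two ends, so
  that consecutive elements of \<open>N\<close> are separated in \<open>Q\<close> by a possibly empty run of valleys. The
  inductive form reads off one run and the peak after it, which is the step of the automaton.\<close>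

inductive peak_chain :: "point list \<Rightarrow> point list \<Rightarrow> bool" where
  base: "bends (-1) (x # run @ [y]) \<Longrightarrow> peak_chain (x # run @ [y]) [x, y]"
| snoc: "\<lbrakk>peak_chain Q N; bends 1 (last_two Q @ [hd (run @ [y])]); bends (-1) (last Q # run @ [y])\<rbrakk>
    \<Longrightarrow> peak_chain (Q @ run @ [y]) (N @ [y])"

lemma peak_chain_ends: "peak_chain Q N \<Longrightarrow> Q \<noteq> [] \<and> 2 \<le> length N \<and> last N = last Q \<and> set N \<subseteq> set Q"
  by (induction rule: peak_chain.induct) auto

context fan_points
begin

lemma chain_infix: "chain (xs @ ys @ zs) \<Longrightarrow> chain ys"
  by (auto simp: chain_def fan_append)

lemma chain_turn: "chain (xs @ a # b # c # ys) \<Longrightarrow> turn a b c \<noteq> 0"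
  using chain_distinct[of "xs @ a # b # c # ys"] by (intro turn_nonzero) (auto simp: chain_def)

text \<open>The last run is found by extending a final piece of the chain to the left as long as the
  turns are valleys.\<close>

lemma peak_chain_exists:
  "chain (pre @ suf) \<Longrightarrow> 2 \<le> length suf \<Longrightarrow> bends (-1) suf \<Longrightarrow> \<exists>N. peak_chain (pre @ suf) N"
proof (induction pre arbitrary: suf rule: rev_induct)
  case Nil
  then obtain x rest where "suf = x # rest" "rest \<noteq> []" by (cases suf; cases "tl suf") auto
  then obtain run y where "suf = x # run @ [y]" by (metis rev_exhaust)
  then show ?case using peak_chain.base Nil by auto
next
  case (snoc w pre)
  obtain a b suf' where s: "suf = a # b # suf'" using snoc(3) by (metis Suc_le_length_iff numeral_2_eq_2)
  show ?case
  proof (cases "turn w a b < 0")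
    case True
    then show ?thesis using snoc(1)[of "w # suf"] snoc(2-4) s by auto
  next
    case False
    then have t: "0 < turn w a b" using chain_turn[of pre w a b suf'] snoc(2) s by auto
    have "chain (pre @ [w, a])" using chain_infix[of "[]" "pre @ [w, a]" "b # suf'"] snoc(2) s by simp
    then obtain N where N: "peak_chain (pre @ [w, a]) N" using snoc(1)[of "[w, a]"] by auto
    obtain run y where r: "b # suf' = run @ [y]" by (metis list.distinct(1) rev_exhaust)
    then have "hd (run @ [y]) = b" by (metis list.sel(1))
    then have "peak_chain ((pre @ [w, a]) @ run @ [y]) (N @ [y])"
      using peak_chain.snoc[OF N, of run y] t snoc(4) s r by simp
    then show ?thesis using s r by (metis append_Cons append_assoc append_Nil)
  qed
qed

section \<open>Lower chains and the saving between consecutive runs\<close>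

text \<open>Here \<open>Q\<close> is the part of the angular chain read so far and \<open>N\<close> its chain of peaks. The cost
  \<open>c\<close> bounds the cuts below a lower chain \<open>L\<close> plus the caps between \<open>L\<close> and \<open>N\<close>.
  Every point read must lie on one of the two chains, as otherwise it could be interior to a cell.\<close>

definition closed_state :: "point list \<Rightarrow> point list \<Rightarrow> nat \<Rightarrow> bool" where
  "closed_state Q N c \<longleftrightarrow> (\<exists>L m. climb L m N \<and> last_two L = last_two Q \<and> reflexes L + m \<le> c \<and>
     set Q \<subseteq> set L \<union> set N)"

text \<open>In addition, the last nonempty run is available for a saving: it lies between the peaks \<open>a\<close> and
  \<open>hd xs\<close>, no run has followed since, and the peaks \<open>xs\<close> after it are peaks of \<open>N\<close> as well, as far as
  their turns in \<open>N\<close> are known. The lower chain is \<open>Y @ a # run @ xs\<close>. The summand 2 stands for the valley at the last point of the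
  run and for the cap of the run; both may be revised.\<close>

definition open_state :: "point list \<Rightarrow> point list \<Rightarrow> nat \<Rightarrow> bool" where
  "open_state Q N c \<longleftrightarrow> (\<exists>Q' N' Y m a run xs. Q = Q' @ a # run @ xs \<and> N = N' @ a # xs \<and>
     climb (Y @ [a]) m (N' @ [a]) \<and> set Q' \<subseteq> insert a (set Y \<union> set N') \<and>
     run \<noteq> [] \<and> xs \<noteq> [] \<and> bends (-1) (a # run @ [hd xs]) \<and>
     bends 1 (last run # xs) \<and> bends 1 (a # xs) \<and>
     reflexes (Y @ a # run) + m + 2 \<le> c)"

lemma chain_last:
  assumes "chain (Q @ zs)" "Q \<noteq> []"
  shows "chain (last Q # zs)"
proof -
  obtain Q' x where "Q = Q' @ [x]" using assms(2) by (metis rev_exhaust)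
  then show ?thesis using assms chain_infix[of Q' "x # zs" "[]"] by simp
qed

lemma closed_empty:
  assumes "closed_state Q N c" "chain (Q @ [y])" "Q \<noteq> []" "last N = last Q" "bends 1 (last_two Q @ [y])"
  shows "closed_state (Q @ [y]) (N @ [y]) c"
proof -
  obtain L m where L: "climb L m N" "last_two L = last_two Q" "reflexes L + m \<le> c" "set Q \<subseteq> set L \<union> set N"
    using assms(1) unfolding closed_state_def by blast
  have "last L = last Q" using climb_chain[OF L(1)] assms(4) by simp
  moreover have "chain [last Q, y]" using chain_last assms(2,3) by simp
  ultimately have "climb (L @ [y]) m (N @ [y])" using climb_extend[OF L(1), of "[y]"] by simp
  moreover have "last_two (L @ [y]) = last_two (Q @ [y])" using last_two_append L(2) by metis
  moreover have "reflexes (L @ [y]) = reflexes L" using reflexes_snoc[of L "[y]"] reflexes_peak assms(5) L(2) by simp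
  ultimately show ?thesis unfolding closed_state_def using L(3,4) by fastforce
qed

lemma closed_run:
  assumes "closed_state Q N c" "chain (Q @ run @ [y])" "Q \<noteq> []" "last N = last Q" "run \<noteq> []"
    "bends 1 (last_two Q @ [hd run])" "bends (-1) (last Q # run @ [y])"
  shows "open_state (Q @ run @ [y]) (N @ [y]) (c + length run + 1)"
proof -
  obtain L m where L: "climb L m N" "last_two L = last_two Q" "reflexes L + m \<le> c" "set Q \<subseteq> set L \<union> set N"
    using assms(1) unfolding closed_state_def by blast
  note ch = climb_chain[OF L(1)]
  obtain Q' x where Q: "Q = Q' @ [x]" using assms(3) by (metis rev_exhaust)
  obtain N' where N: "N = N' @ [x]" using ch assms(4) Q by (metis append_butlast_last_id last_snoc)
  obtain Y where Y: "L = Y @ [x]" using ch assms(4) Q by (metis append_butlast_last_id last_snoc)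
  obtain z zs where z: "run = z # zs" using assms(5) by (cases run) auto
  have "bends (-1) (last Q # run)" using bends_butlast[of "-1" "last Q # run" y] assms(7) by simp
  then have "reflexes (last_two Q @ run) = length zs"
    using reflexes_after_peak[of Q z zs] assms z by simp
  then have "reflexes (L @ run) + m + 2 \<le> c + length run + 1" using reflexes_snoc[of L run] L(2,3) z by simp
  then show ?thesis unfolding open_state_def
    using L Q N Y assms(5,7)
    by (intro exI[of _ Q'] exI[of _ N'] exI[of _ Y] exI[of _ m] exI[of _ x] exI[of _ run] exI[of _ "[y]"]) auto
qed

text \<open>Giving up the option means to cap the run separately.\<close>

lemma open_closed:
  assumes "open_state Q N c" "chain Q"
  shows "closed_state Q N c"
proof -
  obtain Q' N' Y m a run xs where o: "Q = Q' @ a # run @ xs" "N = N' @ a # xs"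
     "climb (Y @ [a]) m (N' @ [a])" "set Q' \<subseteq> insert a (set Y \<union> set N')"
     "run \<noteq> []" "xs \<noteq> []" "bends (-1) (a # run @ [hd xs])"
     "bends 1 (last run # xs)" "bends 1 (a # xs)" "reflexes (Y @ a # run) + m + 2 \<le> c"
    using assms(1) unfolding open_state_def by blast
  obtain h xs' where xs: "xs = h # xs'" using o(6) by (cases xs) auto
  obtain r0 p where r: "run = r0 @ [p]" using o(5) by (metis rev_exhaust)
  have c1: "chain (a # run @ xs)" using chain_infix[of Q' "a # run @ xs" "[]"] assms(2) o(1) by simp
  have cN: "chain (N' @ [a])" using climb_chain[OF o(3)] by blast
  have big: "chain ((N' @ [a]) @ run @ xs)" using chain_join[OF cN] c1 by simp
  have "climb ((Y @ [a]) @ run @ xs) m ((N' @ [a]) @ run @ xs)" using climb_extend[OF o(3)] c1 by simp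
  then have "climb (Y @ a # run @ xs) m (N' @ (a # run @ [h]) @ xs')" by (simp add: xs)
  then have "climb (Y @ a # run @ xs) (Suc m) (N' @ [a, h] @ xs')"
  proof (rule climb.step)
    show "chain (N' @ [a, h] @ xs')" using big xs by (auto simp: chain_def fan_append fan_Cons)
    show "bends (-1) (a # run @ [h])" using o(7) xs by simp
    show "5 \<le> length (a # run @ [h]) + length [a, h]" using o(5) by (cases run) auto
  qed auto
  moreover have "last_two (Y @ a # run @ xs) = last_two Q"
    using last_two_long[of "a # run @ xs"] o(1) xs by simp
  moreover have "reflexes (Y @ a # run @ xs) + Suc m \<le> c"
  proof -
    obtain ws w where w: "a # r0 = ws @ [w]" by (metis list.distinct(1) rev_exhaust)
    have "a # run = ws @ [w, p]" using w r by simp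
    then have lt: "last_two (Y @ a # run) = [w, p]" by (metis append_assoc last_two_pair(1))
    have "reflexes (w # p # xs) \<le> 1 + reflexes (p # xs)" using xs by simp
    also have "reflexes (p # xs) = 0" using reflexes_peak o(8) r by simp
    finally show ?thesis using reflexes_snoc[of "Y @ a # run" xs] lt o(10) by simp
  qed
  ultimately show ?thesis unfolding closed_state_def
    using o(1,2,4) xs by (intro exI[of _ "Y @ a # run @ xs"] exI[of _ "Suc m"]) auto
qed

lemma open_empty:
  assumes "open_state Q N c" "bends 1 (last_two Q @ [y])" "bends 1 (last_two N @ [y])"
  shows "open_state (Q @ [y]) (N @ [y]) c"
proof -
  obtain Q' N' Y m a run xs where o: "Q = Q' @ a # run @ xs" "N = N' @ a # xs"
     "climb (Y @ [a]) m (N' @ [a])" "set Q' \<subseteq> insert a (set Y \<union> set N')"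
     "run \<noteq> []" "xs \<noteq> []" "bends (-1) (a # run @ [hd xs])"
     "bends 1 (last run # xs)" "bends 1 (a # xs)" "reflexes (Y @ a # run) + m + 2 \<le> c"
    using assms(1) unfolding open_state_def by blast
  have len: "2 \<le> length (x # xs)" for x using o(6) by (cases xs) auto
  have "Q = (Q' @ a # butlast run) @ last run # xs" using o(1,5) by simp
  then have "last_two Q = last_two (last run # xs)" using last_two_long[OF len] by metis
  then have "bends 1 (last run # xs @ [y])" using bends_snoc[OF o(8)] assms(2) by simp
  moreover have "last_two N = last_two (a # xs)" using last_two_long[OF len] o(2) by metis
  then have "bends 1 (a # xs @ [y])" using bends_snoc[OF o(9)] assms(3) by simp
  ultimately show ?thesis unfolding open_state_def using o
    by (intro exI[of _ Q'] exI[of _ N'] exI[of _ Y] exI[of _ m] exI[of _ a] exI[of _ run] exI[of _ "xs @ [y]"]) auto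
qed

end

text \<open>A peak \<open>c\<close> between \<open>a\<close> and \<open>d\<close> remains a peak when \<open>a\<close> is replaced by a point below
  the chord from \<open>a\<close> to \<open>c\<close>: the turn is a combination of the old turn and \<open>cross c d\<close>. The next
  lemma is the mirror image.\<close>

lemma turn_from_below:
  assumes "0 < turn a c d" "level a c p \<le> 1" "0 < cross p c" "0 < cross a c" "0 < cross c d"
  shows "0 < turn p c d"
proof -
  define \<alpha> \<beta> where "\<alpha> = cross p c / cross a c" and "\<beta> = cross a p / cross a c"
  have p: "p = \<alpha> *\<^sub>R a + \<beta> *\<^sub>R c" unfolding \<alpha>_def \<beta>_def using wedge_combination[of a c p] assms(4) by simp
  have "0 < \<alpha>" using assms by (simp add: \<alpha>_def)
  have "\<alpha> + \<beta> \<le> 1" using assms(2) by (simp add: level_def \<alpha>_def \<beta>_def add_divide_distrib)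
  have "turn p c d = \<alpha> * turn a c d + (1 - \<alpha> - \<beta>) * cross c d"
    unfolding p turn_def by (simp add: algebra_simps)
  moreover have "0 < \<alpha> * turn a c d" using \<open>0 < \<alpha>\<close> assms(1) by simp
  moreover have "0 \<le> (1 - \<alpha> - \<beta>) * cross c d" using \<open>\<alpha> + \<beta> \<le> 1\<close> assms(5) by simp
  ultimately show ?thesis by linarith
qed

lemma turn_to_below:
  assumes "0 < turn a b d" "level b d p \<le> 1" "0 < cross b p" "0 < cross b d" "0 < cross a b"
  shows "0 < turn a b p"
proof -
  define \<alpha> \<beta> where "\<alpha> = cross p d / cross b d" and "\<beta> = cross b p / cross b d"
  have p: "p = \<alpha> *\<^sub>R b + \<beta> *\<^sub>R d" unfolding \<alpha>_def \<beta>_def using wedge_combination[of b d p] assms(4) by simp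
  have "0 < \<beta>" using assms by (simp add: \<beta>_def)
  have "\<alpha> + \<beta> \<le> 1" using assms(2) by (simp add: level_def \<alpha>_def \<beta>_def add_divide_distrib)
  have "turn a b p = \<beta> * turn a b d + (1 - \<alpha> - \<beta>) * cross a b"
    unfolding p turn_def by (simp add: algebra_simps)
  moreover have "0 < \<beta> * turn a b d" using \<open>0 < \<beta>\<close> assms(1) by simp
  moreover have "0 \<le> (1 - \<alpha> - \<beta>) * cross a b" using \<open>\<alpha> + \<beta> \<le> 1\<close> assms(5) by simp
  ultimately show ?thesis by linarith
qed

lemma valley_below_chord:
  assumes "bends (-1) A" "fan A" "2 \<le> length A" "p \<in> set A"
  shows "level (hd A) (last A) p \<le> 1"
  using chain_level_vs_chord[OF assms(1-3) fan_set_wedge[OF assms(2-4)]] chain_level_vertex[OF assms(2-4)] by simp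

context fan_points
begin

text \<open>The saving. The lower chain skips the peaks \<open>xs\<close> and connects the last point \<open>p\<close> of the old run
  to the first point \<open>q\<close> of the new one. The region up to \<open>N\<close> is then divided as follows.
  If \<open>p\<close> and \<open>q\<close> are valleys of the lower chain, one cap suffices for both runs. If only one of them
  is a valley, its run forms a cap together with \<open>xs\<close>, and the other run has a cap of its own. If
  both are peaks, there are three caps: one for each run and one between \<open>p\<close>, \<open>xs\<close> and \<open>q\<close>. In
  all cases the number of valleys plus the number of caps is the same, and it is one less than with
  separate caps on the unchanged lower chain.\<close>

lemma open_run:
  assumes "open_state Q N c" "chain (Q @ run2 @ [y])" "run2 \<noteq> []" "bends 1 (last_two Q @ [hd run2])"
    "bends (-1) (last Q # run2 @ [y])" "bends 1 (last_two N @ [y])"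
  shows "closed_state (Q @ run2 @ [y]) (N @ [y]) (c + length run2)"
proof -
  obtain Q' N' Y m a run xs where o: "Q = Q' @ a # run @ xs" "N = N' @ a # xs"
     "climb (Y @ [a]) m (N' @ [a])" "set Q' \<subseteq> insert a (set Y \<union> set N')"
     "run \<noteq> []" "xs \<noteq> []" "bends (-1) (a # run @ [hd xs])"
     "bends 1 (last run # xs)" "bends 1 (a # xs)" "reflexes (Y @ a # run) + m + 2 \<le> c"
    using assms(1) unfolding open_state_def by blast
  obtain h xs' where xs: "xs = h # xs'" using o(6) by (cases xs) auto
  obtain xb x where xb: "xs = xb @ [x]" using o(6) by (metis rev_exhaust)
  obtain r0 p where r: "run = r0 @ [p]" using o(5) by (metis rev_exhaust)
  obtain q r2 where q: "run2 = q # r2" using assms(3) by (cases run2) auto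
  obtain z zs where z: "r2 @ [y] = z # zs" by (cases "r2 @ [y]") auto
  obtain ws w where w: "a # r0 = ws @ [w]" by (metis list.distinct(1) rev_exhaust)
  have aw: "a # run = ws @ [w, p]" using w r by simp
  have lx: "last Q = x" using o(1) xb by simp
  have c1: "chain (a # run @ xs @ run2 @ [y])"
    using chain_infix[of Q' "a # run @ xs @ run2 @ [y]" "[]"] assms(2) o(1) by simp
  have cN: "chain (N' @ [a])" using climb_chain[OF o(3)] by blast
  have big: "chain ((N' @ [a]) @ run @ xs @ run2 @ [y])" using chain_join[OF cN] c1 by simp
  have len: "2 \<le> length (u # xs)" for u using o(6) by (cases xs) auto
  have Q2: "last_two Q = last_two (p # xs)"
  proof -
    have "Q = (Q' @ a # r0) @ p # xs" using o(1) r by simp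
    then show ?thesis using last_two_long[OF len] by metis
  qed
  have N2: "last_two N = last_two (a # xs)" using last_two_long[OF len] o(2) by metis
  define L where "L = Y @ a # run @ run2 @ [y]"
  have "chain (a # run @ run2 @ [y])" using c1 by (auto simp: chain_def fan_append fan_Cons)
  then have E0: "climb L m (N' @ a # run @ run2 @ [y])"
    using climb_extend[OF o(3), of "run @ run2 @ [y]"] by (simp add: L_def)
  have R: "reflexes L = reflexes (Y @ a # run) + (if turn w p q < 0 then 1 else 0)
    + (if turn p q z < 0 then 1 else 0) + length r2"
  proof -
    have "last_two (Y @ a # run) = [w, p]" using aw by (metis append_assoc last_two_pair(1))
    then have "reflexes L = reflexes (Y @ a # run) + reflexes (w # p # q # z # zs)"
      using reflexes_snoc[of "Y @ a # run" "run2 @ [y]"] q z by (simp add: L_def)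
    moreover have "bends (-1) (q # r2 @ [y])" using assms(5) q bends_tl by auto
    then have "reflexes (q # z # zs) = length zs" using reflexes_valley[of "q # z # zs"] z by simp
    moreover have "length zs = length r2" using arg_cong[OF z, of length] by simp
    ultimately show ?thesis by simp
  qed
  have tw: "turn w p q \<noteq> 0" "turn p q z \<noteq> 0"
  proof -
    have "chain ((ws @ [w, p]) @ q # z # zs)" using \<open>chain (a # run @ run2 @ [y])\<close> aw q z
      by (metis append_Cons append_assoc)
    then show "turn w p q \<noteq> 0" "turn p q z \<noteq> 0"
      using chain_turn[of ws w p q "z # zs"] chain_turn[of "ws @ [w]" p q z zs] by auto
  qed
  have capA: "bends (-1) (a # run @ [h])" using o(7) xs by simp
  have capB: "bends (-1) (x # run2 @ [y])" using assms(5) lx by simp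
  have peakQ: "bends 1 (p # xs @ [q])" using bends_snoc[of 1 "p # xs" q] o(8) r Q2 assms(4) q by simp
  have peakN: "bends 1 (a # xs @ [y])" using bends_snoc[of 1 "a # xs" y] o(9) N2 assms(6) by simp
  have fA: "fan (a # run @ [h])" "fan (x # run2 @ [y])"
    using c1 unfolding xs chain_def by (auto simp: fan_append fan_Cons)
      (use c1 xb in \<open>auto simp: chain_def fan_append fan_Cons\<close>)
  have valleyA: "bends (-1) (a # run @ [q])" if "turn w p q < 0"
  proof -
    have "bends (-1) (a # run)" using bends_butlast[of "-1" "a # run" h] capA by simp
    then have "bends (-1) (ws @ w # p # [q])"
      unfolding bends_append[of _ ws w p "[q]"] using aw that by simp
    moreover have "a # run @ [q] = ws @ w # p # [q]" using aw by (metis append_Cons append_Nil append_assoc)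
    ultimately show ?thesis by (simp only:)
  qed
  have valleyB: "bends (-1) (p # run2 @ [y])" if "turn p q z < 0"
    using that bends_tl[OF capB] q z by simp
  have "0 < cross p h" "0 < cross a h" "0 < cross h y"
    using c1 unfolding r xs by (auto simp: chain_def fan_append fan_Cons)
  moreover have "0 < cross x q" "0 < cross x y" "0 < cross a x"
    using c1 unfolding q xb by (auto simp: chain_def fan_append fan_Cons)
  ultimately have crosses: "0 < cross p h" "0 < cross a h" "0 < cross h y" "0 < cross x q" "0 < cross x y" "0 < cross a x"
    by auto
  \<comment> \<open>at the last point of \<open>xs\<close> there is a new turn; it is inherited from \<open>N\<close>, unless \<open>xs\<close> is a single point and \<open>p\<close> replaces \<open>a\<close>\<close>
  have peakpy: "bends 1 (p # xs @ [y])"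
  proof (cases xs')
    case Nil
    have "level a h p \<le> 1" using valley_below_chord[OF capA fA(1), of p] r by simp
    moreover have "0 < turn a h y" using peakN xs Nil by simp
    ultimately have "0 < turn p h y" using turn_from_below crosses by blast
    then show ?thesis using xs Nil by simp
  next
    case (Cons u us)
    then have "last_two (p # xs) = last_two (a # xs)" using last_two_long[of xs "[p]"] last_two_long[of xs "[a]"] xs by simp
    then show ?thesis using bends_snoc[of 1 "p # xs" y] o(8) r N2 assms(6) by simp
  qed
  \<comment> \<open>likewise, the new turn is inherited from \<open>Q\<close>, unless \<open>xs\<close> is a single point and \<open>q\<close> replaces \<open>y\<close>\<close>
  have peakaq: "bends 1 (a # xs @ [q])"
  proof (cases xs')
    case Nil
    then have "x = h" using xs xb by simp
    have "level x y q \<le> 1" using valley_below_chord[OF capB fA(2), of q] q by simp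
    moreover have "0 < turn a h y" using peakN xs Nil by simp
    ultimately have "0 < turn a h q" using turn_to_below[of a x y q] crosses \<open>x = h\<close> by blast
    then show ?thesis using xs Nil by simp
  next
    case (Cons u us)
    then have "last_two (p # xs) = last_two (a # xs)" using last_two_long[of xs "[p]"] last_two_long[of xs "[a]"] xs by simp
    then show ?thesis using bends_snoc[of 1 "a # xs" q] o(9) Q2 assms(4) q by simp
  qed
  note chains = big[unfolded chain_def fan_append fan_Cons]
  have close_left: "climb L (Suc k) (N' @ [a, h] @ xs' @ zz)" if "climb L k (N' @ (a # run @ [h]) @ xs' @ zz)" for k zz
  proof (rule climb.step[OF that])
    show "chain (N' @ [a, h] @ xs' @ zz)" using climb_chain[OF that] by (auto simp: chain_def fan_append fan_Cons)
    show "5 \<le> length (a # run @ [h]) + length [a, h]" using o(5) by (cases run) auto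
  qed (use capA in auto)
  have close_right: "climb L (Suc k) (N @ [y])" if "climb L k ((N' @ a # xb) @ (x # run2 @ [y]) @ [])" for k
  proof -
    have "climb L (Suc k) ((N' @ a # xb) @ [x, y] @ [])"
    proof (rule climb.step[OF that])
      show "chain ((N' @ a # xb) @ [x, y] @ [])" using climb_chain[OF that] by (auto simp: chain_def fan_append fan_Cons)
      show "5 \<le> length (x # run2 @ [y]) + length [x, y]" using q by auto
    qed (use capB in auto)
    then show ?thesis using o(2) xb by simp
  qed
  have "\<exists>k. climb L k (N @ [y]) \<and> reflexes L + k \<le> c + length run2"
  proof (cases "turn w p q < 0")
    case True
    show ?thesis
    proof (cases "turn p q z < 0")
      case True
      have v: "bends (-1) (a # run @ run2 @ [y])"
        using bends_append[of "-1" "a # r0" p q "r2 @ [y]"] valleyA[OF \<open>turn w p q < 0\<close>] valleyB[OF True] r q by simp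
      have "climb L (Suc m) (N' @ (a # xs @ [y]) @ [])"
      proof (rule climb.step[OF _ _ v peakN])
        show "climb L m (N' @ (a # run @ run2 @ [y]) @ [])" using E0 by simp
        show "chain (N' @ (a # xs @ [y]) @ [])" using big by (auto simp: chain_def fan_append fan_Cons)
        show "5 \<le> length (a # run @ run2 @ [y]) + length (a # xs @ [y])" using xs q by simp
      qed auto
      then have "climb L (Suc m) (N @ [y])" using o(2) by simp
      then show ?thesis using R True \<open>turn w p q < 0\<close> o(10) q by (intro exI[of _ "Suc m"]) simp
    next
      case False
      have "climb L (Suc m) (N' @ (a # xs @ [q]) @ (r2 @ [y]))"
      proof (rule climb.step[OF _ _ valleyA[OF \<open>turn w p q < 0\<close>] peakaq])
        show "climb L m (N' @ (a # run @ [q]) @ (r2 @ [y]))" using E0 q by simp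
        show "chain (N' @ (a # xs @ [q]) @ (r2 @ [y]))" using big q by (auto simp: chain_def fan_append fan_Cons)
        show "5 \<le> length (a # run @ [q]) + length (a # xs @ [q])" using xs r by simp
      qed auto
      then have "climb L (Suc (Suc m)) (N @ [y])" using q xb by (intro close_right) simp
      then show ?thesis using R False \<open>turn w p q < 0\<close> o(10) q by (intro exI[of _ "Suc (Suc m)"]) simp
    qed
  next
    case nw: False
    show ?thesis
    proof (cases "turn p q z < 0")
      case True
      have "climb L (Suc m) ((N' @ a # r0) @ (p # xs @ [y]) @ [])"
      proof (rule climb.step[OF _ _ valleyB[OF True] peakpy])
        show "climb L m ((N' @ a # r0) @ (p # run2 @ [y]) @ [])" using E0 r by simp
        show "chain ((N' @ a # r0) @ (p # xs @ [y]) @ [])" using big r by (auto simp: chain_def fan_append fan_Cons)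
        show "5 \<le> length (p # run2 @ [y]) + length (p # xs @ [y])" using xs q by simp
      qed auto
      then have "climb L (Suc (Suc m)) (N' @ [a, h] @ xs' @ [y])" using r xs by (intro close_left) simp
      then show ?thesis using R True nw o(2,10) q xs by (intro exI[of _ "Suc (Suc m)"]) simp
    next
      case False
      have "climb L (Suc m) ((N' @ a # r0) @ (p # xs @ [q]) @ (r2 @ [y]))"
      proof (rule climb.step[of _ _ _ "[p, q]", OF _ _ _ peakQ])
        show "climb L m ((N' @ a # r0) @ [p, q] @ (r2 @ [y]))" using E0 r q by simp
        show "chain ((N' @ a # r0) @ (p # xs @ [q]) @ (r2 @ [y]))" using big r q by (auto simp: chain_def fan_append fan_Cons)
        show "5 \<le> length [p, q] + length (p # xs @ [q])" using xs by simp
      qed auto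
      then have "climb L (Suc (Suc m)) (N' @ [a, h] @ xs' @ run2 @ [y])" using r q xs by (intro close_left) simp
      moreover have "N' @ [a, h] @ xs' @ run2 @ [y] = (N' @ a # xb) @ (x # run2 @ [y]) @ []" using xs xb by simp
      ultimately have "climb L (Suc (Suc m)) ((N' @ a # xb) @ (x # run2 @ [y]) @ [])" by (simp only:)
      then have "climb L (Suc (Suc (Suc m))) (N @ [y])" by (rule close_right)
      then show ?thesis using R False nw o(10) q by (intro exI[of _ "Suc (Suc (Suc m))"]) simp
    qed
  qed
  then obtain k where k: "climb L k (N @ [y])" "reflexes L + k \<le> c + length run2" by blast
  have "last_two L = last_two (Q @ run2 @ [y])"
    using last_two_long[of "run2 @ [y]" "Y @ a # run"] last_two_long[of "run2 @ [y]" Q] q by (simp add: L_def)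
  moreover have "set (Q @ run2 @ [y]) \<subseteq> set L \<union> set (N @ [y])" using o(1,2,4) by (auto simp: L_def)
  ultimately show ?thesis unfolding closed_state_def using k by blast
qed

section \<open>Pairs of adjacent valleys in the chain of peaks\<close>

text \<open>On top of the chain of peaks, \<open>v\<close> quadrilaterals have removed two vertices each. The last
  \<open>\<kappa>\<close> vertices are known to be untouched; a further quadrilateral can only use untouched
  vertices.\<close>

definition capped :: "point list \<Rightarrow> nat \<Rightarrow> nat \<Rightarrow> bool" where
  "capped N \<kappa> v \<longleftrightarrow> (\<exists>M' N' z. climb N v (M' @ z) \<and> N = N' @ z \<and> length z = \<kappa> \<and>
     length (M' @ z) + 2 * v = length N)"

lemma capped_mono:
  assumes "capped N \<kappa> v" "\<mu> \<le> \<kappa>"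
  shows "capped N \<mu> v"
proof -
  obtain M' N' z where c: "climb N v (M' @ z)" "N = N' @ z" "length z = \<kappa>"
    "length (M' @ z) + 2 * v = length N" using assms(1) unfolding capped_def by blast
  define z1 z2 where "z1 = take (\<kappa> - \<mu>) z" and "z2 = drop (\<kappa> - \<mu>) z"
  have z: "z = z1 @ z2" "length z2 = \<mu>" using c(3) assms(2) by (auto simp: z1_def z2_def)
  show ?thesis unfolding capped_def
    by (rule exI[of _ "M' @ z1"], rule exI[of _ "N' @ z1"], rule exI[of _ z2]) (use c z in auto)
qed

lemma capped_snoc:
  assumes "capped N \<kappa> v" "chain (last N # [y])"
  shows "capped (N @ [y]) (Suc \<kappa>) v"
proof -
  obtain M' N' z where c: "climb N v (M' @ z)" "N = N' @ z" "length z = \<kappa>"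
    "length (M' @ z) + 2 * v = length N" using assms(1) unfolding capped_def by blast
  have "climb (N @ [y]) v (M' @ z @ [y])" using climb_extend[OF c(1) assms(2)] by simp
  then show ?thesis unfolding capped_def
    by (intro exI[of _ M'] exI[of _ N'] exI[of _ "z @ [y]"]) (use c in auto)
qed

lemma capped_quad:
  assumes "capped N 3 v" "chain (last N # [y])" "N = N' @ [a, b, c]" "turn a b c < 0" "turn b c y < 0"
  shows "capped (N @ [y]) 1 (Suc v)"
proof -
  obtain M' N'' z where z: "climb N v (M' @ z)" "N = N'' @ z" "length z = 3"
    "length (M' @ z) + 2 * v = length N" using assms(1) unfolding capped_def by blast
  then have "z = [a, b, c]" using assms(3) by simp
  have "climb (N @ [y]) v ((M' @ z) @ [y])" using climb_extend[OF z(1) assms(2)] .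
  then have e: "climb (N @ [y]) v (M' @ [a, b, c, y] @ [])" using \<open>z = _\<close> by simp
  have "climb (N @ [y]) (Suc v) (M' @ [a, y] @ [])"
  proof (rule climb.step[OF e])
    show "chain (M' @ [a, y] @ [])" using climb_chain[OF e] by (auto simp: chain_def fan_append fan_Cons)
  qed (use assms in auto)
  then show ?thesis unfolding capped_def
    by (intro exI[of _ "M' @ [a]"] exI[of _ N] exI[of _ "[y]"]) (use z \<open>z = _\<close> in auto)
qed

section \<open>The balance of costs and savings\<close>

text \<open>If \<open>Q\<close> is the whole chain, the final number of cells is at most
  \<open>1 + c + v + (length N - 2 * v - 2)\<close>, and three times this number plus 2 is at most
  \<open>4 * length Q\<close> if and only if the excess is at most 2. Reading an empty run and a peak
  decreases the excess by 1, a single valley and a peak increase it by 1, longer runs are better, and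
  each saving decreases it by 3.\<close>

definition excess :: "point list \<Rightarrow> point list \<Rightarrow> nat \<Rightarrow> nat \<Rightarrow> int" where
  "excess Q N c v = 3 * int c + 3 * int (length N) - 3 * int v - 4 * int (length Q) + 1"

text \<open>Being open is an asset, so a larger excess \<open>j\<close> can be tolerated there than \<open>k\<close> in a closed
  state.\<close>

definition excess_bounded :: "point list \<Rightarrow> point list \<Rightarrow> nat \<Rightarrow> int \<Rightarrow> int \<Rightarrow> bool" where
  "excess_bounded Q N v j k \<longleftrightarrow> (\<exists>c. open_state Q N c \<and> excess Q N c v \<le> j \<or> closed_state Q N c \<and> excess Q N c v \<le> k)"

lemma excess_bounded_empty:
  assumes "excess_bounded Q N v j k" "j \<le> 2" "k \<le> 0" "chain (Q @ [y])" "Q \<noteq> []" "last N = last Q"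
    "bends 1 (last_two Q @ [y])"
  shows "bends 1 (last_two N @ [y]) \<Longrightarrow> excess_bounded (Q @ [y]) (N @ [y]) v 1 0"
    and "k \<le> j \<Longrightarrow> excess_bounded (Q @ [y]) (N @ [y]) v' i (j - 1 - 3 * (int v' - int v))"
proof -
  obtain c where c: "open_state Q N c \<and> excess Q N c v \<le> j \<or> closed_state Q N c \<and> excess Q N c v \<le> k"
    using assms(1) unfolding excess_bounded_def by blast
  have e: "excess (Q @ [y]) (N @ [y]) c v' = excess Q N c v - 1 - 3 * (int v' - int v)" for v'
    by (simp add: excess_def)
  have cQ: "chain Q" using chain_infix[of "[]" Q "[y]"] assms(4) by simp
  show "excess_bounded (Q @ [y]) (N @ [y]) v 1 0" if "bends 1 (last_two N @ [y])"
    using c open_empty[of Q N c y] closed_empty[of Q N c y] assms that unfolding excess_bounded_def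
    by (intro exI[of _ c]) (auto simp: e)
  have "closed_state Q N c" using c open_closed cQ by blast
  then show "excess_bounded (Q @ [y]) (N @ [y]) v' i (j - 1 - 3 * (int v' - int v))" if "k \<le> j"
    using c closed_empty[of Q N c y] assms that unfolding excess_bounded_def
    by (intro exI[of _ c]) (auto simp: e)
qed

lemma excess_bounded_run:
  assumes "excess_bounded Q N v j k" "j \<le> 2" "k \<le> 0" "chain (Q @ run @ [y])" "Q \<noteq> []" "last N = last Q"
    "run \<noteq> []" "bends 1 (last_two Q @ [hd run])" "bends (-1) (last Q # run @ [y])"
  shows "bends 1 (last_two N @ [y]) \<Longrightarrow> excess_bounded (Q @ run @ [y]) (N @ [y]) v 1 0"
    and "k \<le> j \<Longrightarrow> excess_bounded (Q @ run @ [y]) (N @ [y]) v' (j + 1 - 3 * (int v' - int v)) i"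
proof -
  obtain c where c: "open_state Q N c \<and> excess Q N c v \<le> j \<or> closed_state Q N c \<and> excess Q N c v \<le> k"
    using assms(1) unfolding excess_bounded_def by blast
  have len: "1 \<le> length run" using assms(7) by (simp add: Suc_le_eq)
  have e1: "excess (Q @ run @ [y]) (N @ [y]) (c + length run) v \<le> excess Q N c v - 2"
    using len by (simp add: excess_def Suc_le_eq)
  have e2: "excess (Q @ run @ [y]) (N @ [y]) (c + length run + 1) v' \<le> excess Q N c v + 1 - 3 * (int v' - int v)" for v'
    using len by (simp add: excess_def)
  have cQ: "chain Q" using chain_infix[of "[]" Q "run @ [y]"] assms(4) by simp
  have cl: "open_state (Q @ run @ [y]) (N @ [y]) (c + length run + 1)" if "closed_state Q N c"
    using closed_run[of Q N c run y] assms that by blast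
  show "excess_bounded (Q @ run @ [y]) (N @ [y]) v 1 0" if "bends 1 (last_two N @ [y])"
  proof (cases "open_state Q N c \<and> excess Q N c v \<le> j")
    case True
    then have "closed_state (Q @ run @ [y]) (N @ [y]) (c + length run)"
      using open_run[of Q N c run y] assms that by blast
    then show ?thesis using True e1 assms(2) unfolding excess_bounded_def
      by (intro exI[of _ "c + length run"]) auto
  next
    case False
    then show ?thesis using c cl e2[of v] assms(3) unfolding excess_bounded_def
      by (intro exI[of _ "c + length run + 1"]) auto
  qed
  have "closed_state Q N c" using c open_closed cQ by blast
  then show "excess_bounded (Q @ run @ [y]) (N @ [y]) v' (j + 1 - 3 * (int v' - int v)) i" if "k \<le> j"
    using c cl e2[of v'] that unfolding excess_bounded_def
    by (intro exI[of _ "c + length run + 1"]) auto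
qed

text \<open>The states of the automaton. The second alternative says that the last known turn of the chain
  of peaks is a valley. It can be paired with the next vertex, if that is a valley, once
  three vertices are untouched; the closer this is, the larger is the tolerated excess.\<close>

definition excess_invariant :: "point list \<Rightarrow> point list \<Rightarrow> bool" where
  "excess_invariant Q N \<longleftrightarrow> (\<exists>v.
     excess_bounded Q N v 1 0 \<and> capped N 2 v \<or>
     (\<exists>\<kappa>\<in>{1, 2, 3}. excess_bounded Q N v (int \<kappa> - 1) (int \<kappa> - 3) \<and> capped N \<kappa> v \<and>
        (\<exists>N' a b c. N = N' @ [a, b, c] \<and> turn a b c < 0)))"

text \<open>The effect of one step on the excess: the first statement is for a peak of the chain of peaks,
  where an open state can use its saving, and the second one for a valley, which closes the state
  before the new run is read. The growth of \<open>v\<close> in the second statement is a simultaneous saving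
  by a quadrilateral.\<close>

lemma excess_bounded_step:
  assumes "excess_bounded Q N v j k" "j \<le> 2" "k \<le> 0" "k \<le> j" "chain (Q @ run @ [y])" "Q \<noteq> []" "last N = last Q"
    "bends 1 (last_two Q @ [hd (run @ [y])])" "bends (-1) (last Q # run @ [y])"
  shows "bends 1 (last_two N @ [y]) \<Longrightarrow> excess_bounded (Q @ run @ [y]) (N @ [y]) v 1 0"
    and "excess_bounded (Q @ run @ [y]) (N @ [y]) v' (j + 1 - 3 * (int v' - int v)) (j - 1 - 3 * (int v' - int v))"
proof -
  show "excess_bounded (Q @ run @ [y]) (N @ [y]) v 1 0" if "bends 1 (last_two N @ [y])"
    using excess_bounded_empty(1)[of Q N v j k y] excess_bounded_run(1)[of Q N v j k run y] assms that
    by (cases "run = []") simp_all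
  show "excess_bounded (Q @ run @ [y]) (N @ [y]) v' (j + 1 - 3 * (int v' - int v)) (j - 1 - 3 * (int v' - int v))"
    using excess_bounded_empty(2)[of Q N v j k y] excess_bounded_run(2)[of Q N v j k run y] assms
    by (cases "run = []") simp_all
qed

lemma peak_chain_invariant:
  "peak_chain Q N \<Longrightarrow> chain Q \<Longrightarrow> excess_invariant Q N"
proof (induction rule: peak_chain.induct)
  case (base x run y)
  have ch: "chain [x]" "chain ([x] @ run @ [y])" "chain [x, y]"
    using base by (auto simp: chain_def fan_append fan_Cons)
  have "climb [x] 0 [x]" using climb.refl ch by blast
  then have "closed_state [x] [x] 0" unfolding closed_state_def by (intro exI[of _ "[x]"] exI[of _ 0]) auto
  then have "excess_bounded [x] [x] 0 0 0" unfolding excess_bounded_def by (intro exI[of _ 0]) (simp add: excess_def)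
  then have "excess_bounded ([x] @ run @ [y]) ([x] @ [y]) 0 1 0"
    by (rule excess_bounded_step(1)) (use ch base in auto)
  moreover have "capped [x, y] 2 0"
    unfolding capped_def using climb.refl[OF ch(3)]
    by (intro exI[of _ "[]"] exI[of _ "[x, y]"]) auto
  ultimately show ?case unfolding excess_invariant_def by auto
next
  case (snoc Q N run y)
  note pe = peak_chain_ends[OF snoc(1)]
  have cQ: "chain Q" using chain_infix[of "[]" Q "run @ [y]"] snoc(5) by simp
  have cy: "chain (last N # [y])" using chain_last[OF snoc(5)] pe by (auto simp: chain_def fan_append fan_Cons)
  obtain N' b c where N: "N = N' @ [b, c]" using last_two_cases pe by metis
  have cN: "chain (N @ [y])"
  proof -
    have "chain N"
      using snoc.IH[OF cQ] climb_chain unfolding excess_invariant_def capped_def by blast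
    then show ?thesis using chain_join cy N by blast
  qed
  then have t: "turn b c y \<noteq> 0" using chain_turn[of N' b c y "[]"] N by simp
  obtain v where v: "excess_bounded Q N v 1 0 \<and> capped N 2 v \<or>
     (\<exists>\<kappa>\<in>{1, 2, 3}. excess_bounded Q N v (int \<kappa> - 1) (int \<kappa> - 3) \<and> capped N \<kappa> v \<and>
        (\<exists>N' a b c. N = N' @ [a, b, c] \<and> turn a b c < 0))"
    using snoc.IH[OF cQ] unfolding excess_invariant_def by blast
  have common: "chain (Q @ run @ [y])" "Q \<noteq> []" "last N = last Q"
    "bends 1 (last_two Q @ [hd (run @ [y])])" "bends (-1) (last Q # run @ [y])"
    using snoc pe by auto
  show ?case
  proof (cases "turn b c y < 0")
    case False
    then have pk: "bends 1 (last_two N @ [y])" using t N by simp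
    obtain j k \<kappa> where s: "excess_bounded Q N v j k" "j \<le> 2" "k \<le> 0" "k \<le> j" "capped N \<kappa> v" "1 \<le> \<kappa>"
      using v by fastforce
    have "excess_bounded (Q @ run @ [y]) (N @ [y]) v 1 0"
      using excess_bounded_step(1)[OF s(1-4) common pk] .
    moreover have "capped (N @ [y]) 2 v" using capped_mono[OF capped_snoc[OF s(5) cy]] s(6) by simp
    ultimately show ?thesis unfolding excess_invariant_def by blast
  next
    case True
    have last3: "\<exists>M a b c. N @ [y] = M @ [a, b, c] \<and> turn a b c < 0" using N True by auto
    \<comment> \<open>after a peak the new valley is the first of a possible pair; after a valley it waits for untouched vertices or completes a pair\<close>
    consider "excess_bounded Q N v 1 0" "capped N 2 v"
      | \<kappa> where "\<kappa> \<in> {1, 2}" "excess_bounded Q N v (int \<kappa> - 1) (int \<kappa> - 3)" "capped N \<kappa> v"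
      | M a b' c' where "excess_bounded Q N v 2 0" "capped N 3 v" "N = M @ [a, b', c']" "turn a b' c' < 0"
      using v by fastforce
    then show ?thesis
    proof cases
      case 1
      have "excess_bounded (Q @ run @ [y]) (N @ [y]) v (int 3 - 1) (int 3 - 3)"
        using excess_bounded_step(2)[OF 1(1) _ _ _ common, of v] by simp
      moreover have "capped (N @ [y]) 3 v" using capped_snoc[OF 1(2) cy] by (simp add: eval_nat_numeral)
      ultimately show ?thesis unfolding excess_invariant_def using last3 by blast
    next
      case 2
      have "excess_bounded (Q @ run @ [y]) (N @ [y]) v (int (Suc \<kappa>) - 1) (int (Suc \<kappa>) - 3)"
        using excess_bounded_step(2)[OF 2(2) _ _ _ common, of v] 2(1) by (auto simp: algebra_simps)
      moreover have "capped (N @ [y]) (Suc \<kappa>) v" using capped_snoc[OF 2(3) cy] .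
      moreover have "Suc \<kappa> \<in> {1, 2, 3}" using 2(1) by auto
      ultimately show ?thesis unfolding excess_invariant_def using last3 by blast
    next
      case 3
      have "excess_bounded (Q @ run @ [y]) (N @ [y]) (Suc v) (int 1 - 1) (int 1 - 3)"
        using excess_bounded_step(2)[OF 3(1) _ _ _ common, of "Suc v"] by simp
      moreover have "turn b' c' y < 0" using 3(3) N True by simp
      then have "capped (N @ [y]) 1 (Suc v)" using capped_quad[OF 3(2) cy 3(3,4)] by blast
      ultimately show ?thesis unfolding excess_invariant_def using last3 by blast
    qed
  qed
qed

text \<open>The last chain of the automaton is completed to the convex hull by triangles.\<close>

theorem tiled_hull_bound:
  assumes "set ps = P - {0}" "chain ps" "2 \<le> length ps"
  obtains k where "tiled P (convex hull P) k" "3 * k + 2 \<le> 4 * length ps"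
proof -
  obtain x y zs where ps: "ps = zs @ [x, y]" using last_two_cases assms(3) by metis
  then obtain N where N: "peak_chain ps N" using peak_chain_exists[of zs "[x, y]"] assms(2) by auto
  note pe = peak_chain_ends[OF N]
  obtain v j k \<kappa> where "excess_bounded ps N v j k" "j \<le> 2" "k \<le> 2" and cap: "capped N \<kappa> v"
    using peak_chain_invariant[OF N assms(2)] unfolding excess_invariant_def by fastforce
  then obtain c where c: "closed_state ps N c" "excess ps N c v \<le> 2"
    using open_closed[OF _ assms(2)] unfolding excess_bounded_def by fastforce
  obtain L m where L: "climb L m N" "last_two L = last_two ps" "reflexes L + m \<le> c" "set ps \<subseteq> set L \<union> set N"
    using c(1) unfolding closed_state_def by blast
  obtain M where M: "climb N v M" "length M + 2 * v = length N" using cap unfolding capped_def by blast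
  note cL = climb_chain[OF L(1)] and cM = climb_chain[OF M(1)]
  have fL: "fan L" and fN: "fan N" using cL by (auto simp: chain_def)
  have "length (last_two L) = 2" using L(2) ps by simp
  then have lenL: "2 \<le> length L" by (simp add: last_two_def)
  have lenN: "2 \<le> length N" and lenM: "2 \<le> length M" using climb_length[OF L(1) lenL] climb_length[OF M(1)] by auto
  have level: "p \<in> wedge (hd L) (last L) \<and> (chain_level L p = 1 \<or> chain_level N p = 1)" if "p \<in> P - {0}" for p
  proof -
    have "p \<in> set L \<or> p \<in> set N" using that assms(1) L(4) by blast
    then show ?thesis
      using fan_set_wedge[OF fL lenL] fan_set_wedge[OF fN lenN] chain_level_vertex[OF fL lenL]
        chain_level_vertex[OF fN lenN] cL by auto
  qed
  have le: "chain_level N p \<le> chain_level L p" if "p \<in> P - {0}" for p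
    using climb_level[OF L(1)] level that by blast
  have "tiled P (star L) (Suc (reflexes L))"
    by (rule tiled_star) (use cL lenL level le in force)+
  then have "tiled P (star N) (Suc (reflexes L) + m)"
    by (rule tiled_climb[OF L(1) lenL]) (use level in force)
  moreover have sub: "P \<subseteq> star N"
  proof
    fix p assume "p \<in> P"
    show "p \<in> star N"
    proof (cases "p = 0")
      case True
      then show ?thesis using chain_level_zero[OF fN lenN] by (simp add: star_def wedge_def)
    next
      case False
      then show ?thesis using level[of p] le[of p] \<open>p \<in> P\<close> cL by (auto simp: star_def)
    qed
  qed
  ultimately have "tiled P (star M) (Suc (reflexes L) + m + v)"
    using tiled_climb[OF M(1) lenN] by (fastforce simp: star_def)
  then have "tiled P (convex hull P) (Suc (reflexes L) + m + v + (length M - 2))"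
    by (rule tiled_hull) (use cM lenM sub climb_star[OF M(1)] in auto)
  moreover have "3 * (Suc (reflexes L) + m + v + (length M - 2)) + 2 \<le> 4 * length ps"
  proof -
    have "3 * int c + 3 * int (length M) + 3 * int v \<le> 4 * int (length ps) + 1"
      using c(2) M(2) [symmetric] unfolding excess_def by simp
    then have "3 * c + 3 * length M + 3 * v \<le> 4 * length ps + 1" by linarith
    moreover obtain d where "length M = d + 2" using lenM by (metis add.commute le_Suc_ex)
    ultimately show ?thesis using L(3) by simp
  qed
  ultimately show thesis using that by blast
qed

end

section \<open>Decompositions of arbitrary point sets\<close>

lemma inner_point: "u \<bullet> v = u $ 1 * v $ 1 + u $ 2 * v $ 2" for u v :: point
  by (simp add: inner_vec_def sum_2)

text \<open>Points in an open half-plane are ordered around the origin by a real number, the slope with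
  respect to the normal \<open>d\<close> of its boundary. So sorting by angle is sorting by slope.\<close>

lemma cross_slope:
  fixes d u v :: point
  assumes "0 < d \<bullet> u" "0 < d \<bullet> v"
  shows "0 < cross u v \<longleftrightarrow> cross d u / (d \<bullet> u) < cross d v / (d \<bullet> v)"
proof -
  have "d \<noteq> 0" using assms(1) by auto
  then have d: "0 < d \<bullet> d" by simp
  have "(d \<bullet> d) * cross u v = (d \<bullet> u) * cross d v - cross d u * (d \<bullet> v)"
    by (simp add: inner_point cross_def algebra_simps)
  moreover have "0 < cross u v \<longleftrightarrow> 0 < (d \<bullet> d) * cross u v" using d by (metis mult_pos_pos zero_less_mult_pos)
  moreover have "cross d u / (d \<bullet> u) < cross d v / (d \<bullet> v) \<longleftrightarrow> cross d u * (d \<bullet> v) < (d \<bullet> u) * cross d v"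
    using assms by (simp add: divide_less_eq less_divide_eq mult.commute)
  ultimately show ?thesis by linarith
qed

lemma tiled_convex_decomposition:
  assumes "finite P" "tiled P (convex hull P) k"
  obtains D where "convex_decomposition P D" "card D \<le> k"
proof -
  obtain D where D: "finite D" "card D \<le> k" "\<forall>K\<in>D. cell P K"
    "pairwise (\<lambda>K L. disjnt (interior K) (interior L)) D" "\<Union>D = convex hull P"
    using assms(2) unfolding tiled_def by blast
  have "convex_polygon K \<and> vertices K \<subseteq> P \<and> interior K \<inter> P = {}" if K: "K \<in> D" for K
  proof -
    have "cell P K" using D(3) K by blast
    then obtain S where S: "S \<subseteq> P" "K = convex hull S" "\<not> collinear S" "interior K \<inter> P = {}"
      unfolding cell_def by metis
    have "finite S" using S(1) assms(1) finite_subset by blast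
    then have "polytope K" unfolding polytope_def using S(2) by blast
    moreover have "aff_dim K = 2"
      unfolding S(2) aff_dim_convex_hull
      using S(3)[unfolded collinear_aff_dim] aff_dim_le_DIM[of S] by simp
    moreover have "vertices K \<subseteq> P"
      using S(1,2) extreme_points_of_convex_hull[of S] by (auto simp: vertices_def)
    ultimately show ?thesis using S(4) by (simp add: convex_polygon_def)
  qed
  then have "convex_decomposition P D" unfolding convex_decomposition_def using D(4,5) by blast
  then show thesis using that D(2) by blast
qed

text \<open>An extreme point is separated from the convex hull of the other points, which puts these into an
  open half-plane.\<close>

lemma decomposition_from_extreme_origin:
  assumes fin: "finite P" and gp: "general_position P" and card: "3 \<le> card P"
    and ext: "0 extreme_point_of (convex hull P)"
  obtains D where "convex_decomposition P D" "3 * card D + 6 \<le> 4 * card P"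
proof -
  define R where "R = P - {0}"
  have P0: "0 \<in> P" using extreme_point_of_convex_hull[OF ext] .
  have finR: "finite R" and cardR: "card R = card P - 1" using fin P0 by (auto simp: R_def)
  have "convex (convex hull P - {0})" using ext extreme_point_of_stillconvex by blast
  moreover have "R \<subseteq> convex hull P - {0}" using hull_subset[of P convex] by (auto simp: R_def)
  ultimately have "convex hull R \<subseteq> convex hull P - {0}" by (rule hull_minimal[rotated])
  then have "0 \<notin> convex hull R" by blast
  moreover have "closed (convex hull R)" using finR finite_imp_compact_convex_hull compact_imp_closed by blast
  ultimately obtain d b where d: "0 < (b::real)" "\<forall>x\<in>convex hull R. d \<bullet> x > b"
    using separating_hyperplane_closed_0[OF convex_convex_hull] by blast
  have dpos: "0 < d \<bullet> u" if "u \<in> R" for u using d hull_inc[OF that, of convex] by fastforce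
  define slope where "slope u = cross d u / (d \<bullet> u)" for u
  have slope: "0 < cross u v \<longleftrightarrow> slope u < slope v" if "u \<in> R" "v \<in> R" for u v
    unfolding slope_def using cross_slope dpos that by blast
  interpret fan_points P
    using P0 gp slope by unfold_locales (auto simp: R_def [symmetric])
  have "inj_on slope R"
  proof (rule inj_onI, rule ccontr)
    fix u v assume uv: "u \<in> R" "v \<in> R" "slope u = slope v" "u \<noteq> v"
    have "turn 0 u v = cross u v" by (simp add: turn_def)
    then have "cross u v \<noteq> 0" using turn_nonzero[of 0 u v] P0 uv by (auto simp: R_def)
    then show False using slope[of u v] slope[of v u] uv cross_swap[of u v] by auto
  qed
  define ps where "ps = map (the_inv_into R slope) (sorted_list_of_set (slope ` R))"
  have inv: "the_inv_into R slope (slope u) = u" if "u \<in> R" for u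
    using the_inv_into_f_f[OF \<open>inj_on slope R\<close> that] .
  have set: "set ps = R" using finR inv by (auto simp: ps_def image_image)
  have len: "length ps = card P - 1"
    using card_image[OF \<open>inj_on slope R\<close>] cardR by (simp add: ps_def)
  have "sorted_wrt (\<lambda>s t. 0 < cross (the_inv_into R slope s) (the_inv_into R slope t)) (sorted_list_of_set (slope ` R))"
  proof (rule sorted_wrt_mono_rel[of _ "(<)"])
    fix s t assume "s \<in> set (sorted_list_of_set (slope ` R))" "t \<in> set (sorted_list_of_set (slope ` R))" "s < t"
    then obtain u v where "u \<in> R" "v \<in> R" "s = slope u" "t = slope v" using finR by auto
    then show "0 < cross (the_inv_into R slope s) (the_inv_into R slope t)"
      using slope \<open>s < t\<close> inv by simp
  qed simp
  then have "chain ps" using set by (simp add: chain_def fan_def ps_def sorted_wrt_map R_def)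
  moreover have "2 \<le> length ps" using len card by simp
  ultimately obtain k where k: "tiled P (convex hull P) k" "3 * k + 2 \<le> 4 * length ps"
    using tiled_hull_bound[of ps] set by (auto simp: R_def)
  obtain D where D: "convex_decomposition P D" "card D \<le> k"
    using tiled_convex_decomposition[OF fin k(1)] .
  have "3 * card D + 6 \<le> 4 * card P" using D(2) k(2) len card by linarith
  then show thesis using that D(1) by blast
qed

lemma convex_decomposition_translation:
  assumes "convex_decomposition P D"
  shows "convex_decomposition ((+) a ` P) ((`) ((+) a) ` D)"
  unfolding convex_decomposition_def
proof (intro conjI ballI)
  fix K assume "K \<in> (`) ((+) a) ` D"
  then obtain L where L: "L \<in> D" "K = (+) a ` L" by blast
  then have P: "polytope L" "aff_dim L = 2" "vertices L \<subseteq> P" "interior L \<inter> P = {}"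
    using assms by (auto simp: convex_decomposition_def convex_polygon_def)
  show "convex_polygon K"
    using P L(2) by (simp add: convex_polygon_def polytope_translation_eq aff_dim_translation_eq)
  show "vertices K \<subseteq> (+) a ` P"
    using P(3) L(2) extreme_points_of_translation[of a L] by (auto simp: vertices_def)
  show "interior K \<inter> (+) a ` P = {}"
    using P(4) L(2) by (auto simp: interior_translation)
next
  show "\<Union> ((`) ((+) a) ` D) = convex hull (+) a ` P"
    using assms by (simp add: convex_decomposition_def convex_hull_translation flip: image_Union)
  have "disjnt (interior ((+) a ` K)) (interior ((+) a ` L))" if "K \<in> D" "L \<in> D" "(+) a ` K \<noteq> (+) a ` L" for K L
  proof -
    have "K \<noteq> L" using that(3) by blast
    then have "disjnt (interior K) (interior L)"
      using assms that(1,2) by (auto simp: convex_decomposition_def pairwise_def)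
    then show ?thesis by (auto simp: interior_translation disjnt_def)
  qed
  then show "pairwise (\<lambda>K L. disjnt (interior K) (interior L)) ((`) ((+) a) ` D)"
    by (auto simp: pairwise_def)
qed

lemma collinear_turn_zero: "collinear {a, b, c} \<Longrightarrow> turn a b c = 0"
proof -
  assume "collinear {a, b, c}"
  then obtain u where u: "\<And>x y. x \<in> {a, b, c} \<Longrightarrow> y \<in> {a, b, c} \<Longrightarrow> \<exists>k. x - y = k *\<^sub>R u"
    unfolding collinear_def by blast
  obtain k where k: "b - a = k *\<^sub>R u" using u[of b a] by auto
  obtain l where l: "c - a = l *\<^sub>R u" using u[of c a] by auto
  have "turn a b c = cross (b - a) (c - a)" by (simp add: turn_def cross_def algebra_simps)
  also have "\<dots> = 0" unfolding k l by simp
  finally show ?thesis .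
qed

lemma general_position_translation:
  assumes "general_position P"
  shows "general_position ((+) a ` P)"
proof -
  have "\<not> collinear {a + x, a + y, a + z}" if "x \<in> P" "y \<in> P" "z \<in> P" "x \<noteq> y" "x \<noteq> z" "y \<noteq> z" for x y z
  proof
    assume "collinear {a + x, a + y, a + z}"
    moreover have "turn (a + x) (a + y) (a + z) = turn x y z"
      by (simp add: turn_def cross_def algebra_simps)
    ultimately have "collinear {x, y, z}"
      using collinear_turn_zero[of "a + x" "a + y" "a + z"] turn_zero_collinear[of x y z] that(4) by simp
    then show False using assms that unfolding general_position_def by blast
  qed
  then show ?thesis unfolding general_position_def by auto
qed

theorem convex_decomposition_bound:
  assumes "finite P" "general_position P" "3 \<le> card P"
  obtains D where "convex_decomposition P D" "3 * card D + 6 \<le> 4 * card P"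
proof -
  have "convex hull P \<noteq> {}" using assms(3) by (auto simp: convex_hull_eq_empty)
  then obtain q where q: "q extreme_point_of (convex hull P)"
    using extreme_point_exists_convex[OF finite_imp_compact_convex_hull[OF assms(1)] convex_convex_hull] by blast
  define P' where "P' = (+) (- q) ` P"
  have cardP': "card P' = card P" unfolding P'_def by (rule card_image) simp
  have "0 extreme_point_of (convex hull P')"
    using q extreme_point_of_translation_eq[of "- q" q "convex hull P"]
    unfolding P'_def convex_hull_translation[of "- q"] by simp
  moreover have "general_position P'"
    unfolding P'_def by (rule general_position_translation[OF assms(2)])
  moreover have "finite P'" "3 \<le> card P'" using assms cardP' by (auto simp: P'_def)
  ultimately obtain D where D: "convex_decomposition P' D" "3 * card D + 6 \<le> 4 * card P'"
    using decomposition_from_extreme_origin[of P'] by metis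
  have "(+) q ` P' = P" by (auto simp: P'_def image_image)
  then have "convex_decomposition P ((`) ((+) q) ` D)" using convex_decomposition_translation[OF D(1), of q] by simp
  moreover have "card ((`) ((+) q) ` D) = card D"
    by (rule card_image) (auto simp: inj_on_def inj_image_eq_iff)
  ultimately show thesis using that D(2) cardP' by metis
qed

text \<open>Points on a parabola: the turn of three of them is a Vandermonde determinant. Without such a set
  the maximum in question would be taken over the empty set.\<close>

lemma general_position_exists:
  obtains P :: "point set" where "finite P" "card P = n" "general_position P"
proof -
  define f :: "nat \<Rightarrow> point" where "f i = vector [real i, (real i)\<^sup>2]" for i
  have f1: "f i $ 1 = real i" "f i $ 2 = (real i)\<^sup>2" for i by (simp_all add: f_def)
  have inj: "inj f" by (rule injI) (metis f1(1) of_nat_eq_iff)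
  have "turn (f i) (f j) (f k) \<noteq> 0" if "i \<noteq> j" "i \<noteq> k" "j \<noteq> k" for i j k
  proof -
    have "turn (f i) (f j) (f k) = (real j - real i) * (real k - real i) * (real k - real j)"
      by (simp add: turn_def cross_def f1 power2_eq_square algebra_simps)
    then show ?thesis using that by simp
  qed
  then have "\<not> collinear {f i, f j, f k}" if "f i \<noteq> f j" "f i \<noteq> f k" "f j \<noteq> f k" for i j k
    using that collinear_turn_zero[of "f i" "f j" "f k"] by metis
  then have "general_position (f ` {..<n})" unfolding general_position_def by auto
  moreover have "card (f ` {..<n}) = n" using inj by (simp add: card_image inj_on_subset[OF inj])
  ultimately show thesis using that[of "f ` {..<n}"] by simp
qed

theorem theorem2:
  fixes n :: nat
  assumes "n \<ge> 3"
  shows "real (max_min_decomposition n) \<le> 4 / 3 * real n - 2"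
proof -
  let ?S = "{min_decomposition P | P. finite P \<and> card P = n \<and> general_position P}"
  have bound: "3 * k + 6 \<le> 4 * n" if k: "k \<in> ?S" for k
  proof -
    obtain P where P: "k = min_decomposition P" "finite P" "card P = n" "general_position P"
      using k by blast
    obtain D where D: "convex_decomposition P D" "3 * card D + 6 \<le> 4 * card P"
      using convex_decomposition_bound P assms by blast
    have "min_decomposition P \<le> card D"
      unfolding min_decomposition_def using D(1) by (intro Least_le) blast
    then show ?thesis using P D(2) by linarith
  qed
  have "?S \<subseteq> {..4 * n}" using bound by fastforce
  then have "finite ?S" using finite_subset by blast
  moreover obtain P0 where "finite P0" "card P0 = n" "general_position P0"
    by (rule general_position_exists)
  then have "min_decomposition P0 \<in> ?S" by blast
  then have "?S \<noteq> {}" by blast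
  ultimately have "Max ?S \<in> ?S" by (rule Max_in)
  then have "3 * max_min_decomposition n + 6 \<le> 4 * n" unfolding max_min_decomposition_def by (rule bound)
  then have "3 * real (max_min_decomposition n) + 6 \<le> 4 * real n" by linarith
  then show ?thesis by simp
qed

end
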